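(* $FC(3,6) = 4$ and $7 \leq FC(4,6) \leq 8$.
   Context: All families of sets are finite families of finite sets. $[n]=\{1,\ldots,n\}$ and $\mathcal{P}(n)$ is the power set of $[n]$. A family $\mathcal{A}$ is union-closed if $A \cup B \in \mathcal{A}$ for all $A,B \in \mathcal{A}$. An $FC(k)$-family is a union-closed family $\mathcal{B}$ containing $\emptyset$ and whose largest set has $k$ elements, such that for every union-closed family $\mathcal{A} \supseteq \mathcal{B}$, one of the $k$ elements of the largest set of $\mathcal{B}$ belongs to at least half of the sets of $\mathcal{A}$. A family is $FC$ (an $FC$-family) if it is $FC(k)$ for some $k$. The family generated by a set system $\mathcal{S} \subset \mathcal{P}(n)$ is the smallest union-closed family containing $\mathcal{S} \cup \{\emptyset\}$. $FC(k,n)$ denotes the minimal $m$ such that any $m$ (distinct) $k$-element subsets of $[n]$ generate an $FC$-family. *)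

theory Defs
  imports Main "HOL.Hull"
begin

definition finite_family :: "'a set set \<Rightarrow> bool" where
  "finite_family A \<longleftrightarrow> finite A \<and> (\<forall>X\<in>A. finite X)"

definition union_closed :: "'a set set \<Rightarrow> bool" where
  "union_closed A \<longleftrightarrow> (\<forall>X\<in>A. \<forall>Y\<in>A. X \<union> Y \<in> A)"

text \<open>The largest set of a finite union-closed family is its greatest element with respect to
  inclusion, equivalently its unique member of maximal cardinality.\<close>

definition FC_family_of :: "nat \<Rightarrow> 'a set set \<Rightarrow> bool" where
  "FC_family_of k B \<longleftrightarrow>
     finite_family B \<and> union_closed B \<and> {} \<in> B \<and>
     (\<exists>M\<in>B. (\<forall>X\<in>B. X \<subseteq> M) \<and> card M = k \<and>
        (\<forall>A. finite_family A \<and> union_closed A \<and> B \<subseteq> A \<longrightarrow>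
           (\<exists>x\<in>M. card A \<le> 2 * card {X\<in>A. x \<in> X})))"

definition FC_family :: "'a set set \<Rightarrow> bool" where
  "FC_family B \<longleftrightarrow> (\<exists>k. FC_family_of k B)"

definition generated :: "'a set set \<Rightarrow> 'a set set" where
  "generated S = union_closed hull (S \<union> {{}})"

text \<open>The ground type of the families is \<^typ>\<open>nat\<close>, so the union-closed families extending a
  generated family may use arbitrarily many elements outside \<^term>\<open>{1..n::nat}\<close>.
  The condition on \<open>m\<close> holds vacuously once \<open>m\<close> exceeds \<open>n choose k\<close>, so the minimum
  always exists.\<close>

definition FC_number :: "nat \<Rightarrow> nat \<Rightarrow> nat" where
  "FC_number k n =
     (LEAST m. \<forall>S \<subseteq> {X. X \<subseteq> {1..n} \<and> card X = k}. card S = m \<longrightarrow> FC_family (generated S))"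

end

theory Submission
  imports Defs
begin

text \<open>Upper bounds. Let \<open>A\<close> be a union-closed family containing the generators, and give the points of
  their union \<open>M\<close> nonnegative weights \<open>c\<close>. Score \<open>X\<close> by the weight of \<open>X \<inter> M\<close> minus the weight of
  \<open>M - X\<close>. If all points of \<open>M\<close> were rare, the total score of \<open>A\<close> would be negative; but \<open>A\<close> splits
  into fibres with a fixed part outside \<open>M\<close>, and the traces of a fibre on \<open>M\<close> form a union-closed
  family that absorbs the generators. So it suffices that every such family of subsets of \<open>M\<close> has
  nonnegative score (Poonen). This is a small integer program, solved by a branching certificate with
  LP-dual leaves. Six configurations of triples and three of quadruples (the latter are complements of
  graphs on 6 vertices: a 4-star with a pendant edge, a hexagon, and a 7-edge graph) turn out
  to be unavoidable among any 4 triples or any 8 quadruples in a 6-set.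

  Lower bounds. Conversely, families of subsets of \<open>M\<close> that absorb the generators and whose
  scores sum to something negative at every point can be glued, using new points, into a union-closed family
  in which every point of \<open>M\<close> is rare.\<close>

subsection \<open>Generated families\<close>

lemma union_closed_Inter: "(\<And>A. A \<in> \<A> \<Longrightarrow> union_closed A) \<Longrightarrow> union_closed (\<Inter>\<A>)"
  by (auto simp: union_closed_def)

lemma union_closed_generated: "union_closed (generated S)"
  unfolding generated_def by (rule hull_in) (simp add: union_closed_Inter)

lemma generated_superset: "insert {} S \<subseteq> generated S"
  unfolding generated_def using hull_subset[of "S \<union> {{}}" union_closed] by simp

lemma generated_minimal: "S \<subseteq> A \<Longrightarrow> {} \<in> A \<Longrightarrow> union_closed A \<Longrightarrow> generated S \<subseteq> A"
  unfolding generated_def by (rule hull_minimal) auto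

lemma generated_subset_Pow: "generated S \<subseteq> Pow (\<Union>S)"
  by (rule generated_minimal) (auto simp: union_closed_def)

lemma Union_in_union_closed:
  assumes "finite S" "S \<subseteq> A" "{} \<in> A" "union_closed A"
  shows "\<Union>S \<in> A"
  using assms by (induction S rule: finite_induct) (auto simp: union_closed_def)

lemma Union_in_generated: "finite S \<Longrightarrow> \<Union>S \<in> generated S"
  using Union_in_union_closed[of S "generated S"] generated_superset union_closed_generated by blast

lemma finite_family_generated: "finite_family S \<Longrightarrow> finite_family (generated S)"
  unfolding finite_family_def
  by (metis PowD finite_Pow_iff finite_Union finite_subset generated_subset_Pow subsetD)

text \<open>The union of the generators is itself generated and contains every generated set, so it
  serves as the largest set in the definition.\<close>

lemma FC_family_generatedI:
  assumes "finite_family S"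
    and "\<And>A. finite_family A \<Longrightarrow> union_closed A \<Longrightarrow> generated S \<subseteq> A \<Longrightarrow>
           \<exists>x\<in>\<Union>S. card A \<le> 2 * card {X\<in>A. x \<in> X}"
  shows "FC_family (generated S)"
proof -
  have "\<Union>S \<in> generated S" "\<forall>X\<in>generated S. X \<subseteq> \<Union>S" "{} \<in> generated S"
    using assms(1) Union_in_generated[of S] generated_subset_Pow[of S] generated_superset[of S]
    by (auto simp: finite_family_def)
  then have "FC_family_of (card (\<Union>S)) (generated S)"
    unfolding FC_family_of_def using assms
    by (intro conjI bexI[of _ "\<Union>S"] finite_family_generated union_closed_generated) auto
  then show ?thesis
    unfolding FC_family_def by blast
qed

subsection \<open>Coding the subsets of a list of points\<close>

fun sel :: "'a list \<Rightarrow> bool list \<Rightarrow> 'a list" where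
  "sel (a # as) (b # bs) = (if b then a # sel as bs else sel as bs)"
| "sel as bs = []"

abbreviation join :: "bool list \<Rightarrow> bool list \<Rightarrow> bool list" where
  "join \<equiv> map2 (\<or>)"

lemma sel_subset: "set (sel ps bs) \<subseteq> set ps"
  by (induction ps bs rule: sel.induct) auto

lemma set_sel_join:
  "length bs = length ps \<Longrightarrow> length cs = length ps \<Longrightarrow>
     set (sel ps (join bs cs)) = set (sel ps bs) \<union> set (sel ps cs)"
proof (induction ps arbitrary: bs cs)
  case (Cons p ps)
  then show ?case by (cases bs; cases cs) auto
qed simp

lemma sel_map: "sel (map f ps) bs = map f (sel ps bs)"
  by (induction ps bs rule: sel.induct) auto

lemma sel_member: "sel ps (map (\<lambda>p. p \<in> X) ps) = filter (\<lambda>p. p \<in> X) ps"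
  by (induction ps) auto

subsection \<open>The weighted frequency criterion\<close>

abbreviation sgn_in :: "'a \<Rightarrow> 'a set \<Rightarrow> int" where
  "sgn_in a X \<equiv> (if a \<in> X then 1 else -1)"

text \<open>A point is rare exactly when this sum is negative. Unlike a frequency, the sum adds up
  over the pieces of a partition of \<open>A\<close>.\<close>

lemma sum_sgn_in: "finite A \<Longrightarrow> (\<Sum>X\<in>A. sgn_in a X) = 2 * int (card {X\<in>A. a \<in> X}) - int (card A)"
proof (induction A rule: finite_induct)
  case (insert Y A)
  have "{X \<in> insert Y A. a \<in> X} = (if a \<in> Y then insert Y {X\<in>A. a \<in> X} else {X\<in>A. a \<in> X})"
    by auto
  then show ?case using insert by simp
qed simp

fun weight :: "'a list \<Rightarrow> int list \<Rightarrow> 'a set \<Rightarrow> int" where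
  "weight (a # as) (c # cs) X = c * sgn_in a X + weight as cs X"
| "weight as cs X = 0"

text \<open>A table of integers indexed by bit lists of one fixed length: the path to a leaf is its
  index, with \<open>False\<close> going left. It lets \<open>total\<close> be evaluated by
  computation while the family \<open>P\<close> stays arbitrary.\<close>

datatype trie = Tip int | Node trie trie

fun total :: "(bool list \<Rightarrow> bool) \<Rightarrow> trie \<Rightarrow> int" where
  "total P (Tip x) = (if P [] then x else 0)"
| "total P (Node l r) = total (\<lambda>bs. P (False # bs)) l + total (\<lambda>bs. P (True # bs)) r"

text \<open>The accumulator \<open>x\<close> is the score of the points already decided, so the leaf
  for \<open>bs\<close> ends up with the start value plus the signed weight of the set coded by
  \<open>bs\<close>.\<close>

fun scores :: "int list \<Rightarrow> int \<Rightarrow> trie" where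
  "scores [] x = Tip x"
| "scores (c # cs) x = Node (scores cs (x - c)) (scores cs (x + c))"

text \<open>Deciding whether the first point belongs to \<open>X\<close> splits the fibre over
  \<open>K\<close> into two fibres for the shorter list, over \<open>K\<close> and over
  \<open>insert p K\<close>. These are the two subtrees, and \<open>x\<close> absorbs the decided
  weight.\<close>

lemma sum_weight_fibre:
  assumes "finite A" "distinct ps" "length cs = length ps" "K \<inter> set ps = {}"
  shows "(\<Sum>X | X \<in> A \<and> X - set ps = K. x + weight ps cs X) =
           total (\<lambda>bs. set (sel ps bs) \<union> K \<in> A) (scores cs x)"
  using assms(2-)
proof (induction ps arbitrary: cs K x)
  case Nil
  have "{X. X \<in> A \<and> X = K} = (if K \<in> A then {K} else {})" by auto
  with Nil show ?case by simp
next
  case (Cons p ps)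
  obtain c cs' where cs: "cs = c # cs'" and len: "length cs' = length ps"
    using Cons.prems(2) by (cases cs) auto
  have p: "p \<notin> K" "p \<notin> set ps" "K \<inter> set ps = {}" "distinct ps" "insert p K \<inter> set ps = {}"
    using Cons.prems by auto
  let ?A0 = "{X. X \<in> A \<and> X - set ps = K}" and ?A1 = "{X. X \<in> A \<and> X - set ps = insert p K}"
  have split: "{X. X \<in> A \<and> X - set (p # ps) = K} = ?A0 \<union> ?A1" using p by auto
  have "(\<Sum>X | X \<in> A \<and> X - set (p # ps) = K. x + weight (p # ps) cs X) =
      (\<Sum>X\<in>?A0. x + weight (p # ps) cs X) + (\<Sum>X\<in>?A1. x + weight (p # ps) cs X)"
    unfolding split using assms(1) p by (subst sum.union_disjoint) auto
  also have "(\<Sum>X\<in>?A0. x + weight (p # ps) cs X) = (\<Sum>X\<in>?A0. x - c + weight ps cs' X)"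
    using p by (intro sum.cong) (auto simp: cs)
  also have "\<dots> = total (\<lambda>bs. set (sel ps bs) \<union> K \<in> A) (scores cs' (x - c))"
    by (rule Cons.IH) (use p len in auto)
  also have "(\<Sum>X\<in>?A1. x + weight (p # ps) cs X) = (\<Sum>X\<in>?A1. x + c + weight ps cs' X)"
    using p by (intro sum.cong) (auto simp: cs)
  also have "\<dots> = total (\<lambda>bs. set (sel ps bs) \<union> insert p K \<in> A) (scores cs' (x + c))"
    by (rule Cons.IH) (use p len in auto)
  finally show ?case by (simp add: cs)
qed

text \<open>\<open>P\<close> is meant to be the set of codes of the traces on \<open>ps\<close> of the members of \<open>A\<close> that have a
  fixed part outside \<open>ps\<close>.\<close>

definition absorbing :: "nat \<Rightarrow> bool list list \<Rightarrow> (bool list \<Rightarrow> bool) \<Rightarrow> bool" where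
  "absorbing n T P \<longleftrightarrow>
     (\<forall>x y. length x = n \<longrightarrow> length y = n \<longrightarrow> P x \<longrightarrow> P y \<longrightarrow> P (join x y)) \<and>
     (\<forall>x. \<forall>t\<in>set T. length x = n \<longrightarrow> P x \<longrightarrow> P (join x t))"

definition nonneg_scores :: "bool list list \<Rightarrow> int list \<Rightarrow> bool" where
  "nonneg_scores T cs \<longleftrightarrow> (\<forall>P. absorbing (length cs) T P \<longrightarrow> 0 \<le> total P (scores cs 0))"

lemma weight_sum:
  assumes "finite A" "length cs = length ps"
  shows "(\<Sum>X\<in>A. weight ps cs X) = (\<Sum>(p, c)\<leftarrow>zip ps cs. c * (\<Sum>X\<in>A. sgn_in p X))"
  using assms(2)[symmetric]
  by (induction ps cs rule: list_induct2) (simp_all add: sum.distrib sum_distrib_left)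

lemma weighted_criterion:
  assumes S: "finite_family S" and ps: "distinct ps" "length cs = length ps"
    and T: "\<forall>t\<in>set T. length t = length cs \<and> set (sel ps t) \<in> S"
    and cov: "set ps \<subseteq> \<Union>S"
    and cs: "\<forall>c\<in>set cs. 0 \<le> c" "0 < sum_list cs"
    and nn: "nonneg_scores T cs"
  shows "FC_family (generated S)"
proof (rule FC_family_generatedI[OF S], rule ccontr)
  fix A assume A: "finite_family A" "union_closed A" "generated S \<subseteq> A"
    and "\<not> (\<exists>x\<in>\<Union>S. card A \<le> 2 * card {X\<in>A. x \<in> X})"
  moreover have fin: "finite A" using A(1) by (simp add: finite_family_def)
  ultimately have neg: "(\<Sum>X\<in>A. sgn_in p X) < 0" if "p \<in> set ps" for p
    using cov that by (force simp: sum_sgn_in[OF fin] not_le)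
  have SA: "S \<subseteq> A" using A(3) generated_superset by blast
  have "(\<Sum>X\<in>A. weight ps cs X) < 0"
  proof -
    \<comment> \<open>By integrality, each rare point has a sum of at most -1, so a positive total
      weight makes the whole score strictly negative.\<close>
    have "(\<Sum>(p, c)\<leftarrow>zip ps cs. c * (\<Sum>X\<in>A. sgn_in p X)) \<le> (\<Sum>(p, c)\<leftarrow>zip ps cs. - c)"
    proof (rule sum_list_mono, clarsimp)
      fix p c assume "(p, c) \<in> set (zip ps cs)"
      then have "0 \<le> c" "(\<Sum>X\<in>A. sgn_in p X) \<le> -1"
        using cs(1) neg[of p] by (auto dest: set_zip_leftD set_zip_rightD)
      then show "c * (\<Sum>X\<in>A. sgn_in p X) \<le> - c"
        using mult_left_mono[of "\<Sum>X\<in>A. sgn_in p X" "-1" c] by simp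
    qed
    also have "(\<Sum>(p, c)\<leftarrow>zip ps cs. - c) = - sum_list cs"
      using ps(2)[symmetric] by (induction ps cs rule: list_induct2) simp_all
    finally show ?thesis using weight_sum[OF fin ps(2)] cs(2) by simp
  qed
  moreover have "0 \<le> (\<Sum>X\<in>A. weight ps cs X)"
  proof -
    have "(\<Sum>X\<in>A. weight ps cs X) =
        (\<Sum>K\<in>(\<lambda>X. X - set ps) ` A. \<Sum>X | X \<in> A \<and> X - set ps = K. weight ps cs X)"
      by (rule sum.image_gen[OF fin])
    moreover have "0 \<le> (\<Sum>X | X \<in> A \<and> X - set ps = K. weight ps cs X)"
      if "K \<in> (\<lambda>X. X - set ps) ` A" for K
    proof -
      \<comment> \<open>Unions within the fibre keep the outside part \<open>K\<close>. So do unions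
        with a set from \<open>T\<close>, which is a member of \<open>A\<close> contained in
        \<open>set ps\<close>.\<close>
      define P where "P = (\<lambda>bs. set (sel ps bs) \<union> K \<in> A)"
      have "absorbing (length cs) T P"
        unfolding absorbing_def
      proof (intro conjI allI impI ballI)
        fix x y assume "length x = length cs" "length y = length cs" "P x" "P y"
        moreover have "set (sel ps x) \<union> set (sel ps y) \<union> K =
            (set (sel ps x) \<union> K) \<union> (set (sel ps y) \<union> K)" by blast
        ultimately show "P (join x y)"
          using A(2) ps(2) by (simp add: P_def set_sel_join union_closed_def)
      next
        fix x t assume "t \<in> set T" "length x = length cs" "P x"
        moreover have "set (sel ps x) \<union> set (sel ps t) \<union> K =
            (set (sel ps x) \<union> K) \<union> set (sel ps t)" by blast
        ultimately show "P (join x t)"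
          using A(2) ps(2) T SA by (auto simp: P_def set_sel_join union_closed_def)
      qed
      then have "0 \<le> total P (scores cs 0)" using nn by (simp add: nonneg_scores_def)
      also have "\<dots> = (\<Sum>X | X \<in> A \<and> X - set ps = K. 0 + weight ps cs X)"
        unfolding P_def by (rule sum_weight_fibre[symmetric]) (use fin ps that in auto)
      finally show ?thesis by simp
    qed
    ultimately show ?thesis by (simp add: sum_nonneg)
  qed
  ultimately show False by simp
qed

subsection \<open>Certificates for nonnegative scores\<close>

fun add_at :: "int \<Rightarrow> bool list \<Rightarrow> trie \<Rightarrow> trie" where
  "add_at d (b # bs) (Node l r) = (if b then Node l (add_at d bs r) else Node (add_at d bs l) r)"
| "add_at d bs (Node l r) = Node l r"
| "add_at d bs (Tip x) = Tip (x + d)"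

fun full :: "nat \<Rightarrow> trie \<Rightarrow> bool" where
  "full 0 t \<longleftrightarrow> (\<exists>x. t = Tip x)"
| "full (Suc n) t \<longleftrightarrow> (\<exists>l r. t = Node l r \<and> full n l \<and> full n r)"

fun neg_part :: "trie \<Rightarrow> int" where
  "neg_part (Tip x) = min x 0"
| "neg_part (Node l r) = neg_part l + neg_part r"

lemma full_scores: "full (length cs) (scores cs x)"
  by (induction cs arbitrary: x) auto

lemma full_add_at: "full n t \<Longrightarrow> length bs = n \<Longrightarrow> full n (add_at d bs t)"
  by (induction bs arbitrary: n t) auto

lemma total_add_at:
  "full n t \<Longrightarrow> length bs = n \<Longrightarrow> total P (add_at d bs t) = total P t + (if P bs then d else 0)"
proof (induction bs arbitrary: n t P)
  case (Cons b bs)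
  then obtain l r where "t = Node l r" "full (length bs) l" "full (length bs) r" by auto
  then show ?case using Cons.IH by (cases b) simp_all
qed auto

text \<open>The smallest total over all predicates selects exactly the negative leaves. This is the
  relaxation left over once the closure conditions have been moved into the scores.\<close>

lemma neg_part_le_total: "neg_part t \<le> total P t"
  by (induction t arbitrary: P) (auto intro: add_mono)

lemma total_scores_scaled: "total P (scores (map ((*) k) cs) (k * x)) = k * total P (scores cs x)"
  by (induction cs arbitrary: P x)
    (simp_all add: distrib_left[symmetric] right_diff_distrib[symmetric])

definition add_all :: "(bool list \<times> int) list \<Rightarrow> trie \<Rightarrow> trie" where
  "add_all = fold (\<lambda>(bs, d). add_at d bs)"

abbreviation gain :: "(bool list \<Rightarrow> bool) \<Rightarrow> (bool list \<times> int) list \<Rightarrow> int" where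
  "gain P ds \<equiv> (\<Sum>(bs, d)\<leftarrow>ds. if P bs then d else 0)"

lemma total_add_all:
  "full n t \<Longrightarrow> \<forall>(bs, d)\<in>set ds. length bs = n \<Longrightarrow> total P (add_all ds t) = total P t + gain P ds"
proof (induction ds arbitrary: t)
  case (Cons x ds)
  obtain bs d where x: "x = (bs, d)" by (cases x)
  have "total P (add_all ds (add_at d bs t)) = total P (add_at d bs t) + gain P ds"
    using Cons.prems by (intro Cons.IH) (auto simp: x intro: full_add_at)
  moreover have "total P (add_at d bs t) = total P t + (if P bs then d else 0)"
    using Cons.prems by (intro total_add_at) (auto simp: x)
  ultimately show ?case by (simp add: add_all_def x)
qed (simp add: add_all_def)

lemma gain_append: "gain P (ds @ es) = gain P ds + gain P es"
  by simp

lemma gain_concat_le: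
  assumes "\<And>m. m \<in> set ms \<Longrightarrow> gain P (f m) \<le> g m"
  shows "gain P (concat (map f ms)) \<le> sum_list (map g ms)"
  using assms by (induction ms) (auto intro: add_mono)

section \<open>Branching certificates with linear programming leaves\<close>

fun dec :: "nat \<Rightarrow> int \<Rightarrow> bool list" where
  "dec 0 m = []"
| "dec (Suc n) m = odd m # dec n (m div 2)"

lemma length_dec [simp]: "length (dec n m) = n"
  by (induction n arbitrary: m) auto

text \<open>\<open>Split x\<close> branches on whether the set coded by \<open>x\<close> belongs to
  the family; the first subtree is the case that it does. \<open>Leaf\<close> holds a scaling
  factor, by which fractional dual multipliers become integers, and then the multipliers for
  absorption, for unions, for sets known to be present and for sets known to be absent.\<close>

datatype cert =
    Split int cert cert
  | Leaf int "(int \<times> int \<times> int) list" "(int \<times> int \<times> int) list" "(int \<times> int) list" "(int \<times> int) list"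

text \<open>Under the conditions of \<open>check\<close>, an entry with multiplier \<open>a\<close>
  adds at most \<open>0\<close>, \<open>a\<close>, \<open>- a\<close> and \<open>0\<close> to the
  total in the four groups, in this order. The constants are accounted for in
  \<open>check\<close>.\<close>

definition changes ::
  "nat \<Rightarrow> (int \<times> int \<times> int) list \<Rightarrow> (int \<times> int \<times> int) list \<Rightarrow>
     (int \<times> int) list \<Rightarrow> (int \<times> int) list \<Rightarrow> (bool list \<times> int) list" where
  "changes n ms js ps qs =
     concat (map (\<lambda>(x, b, a). [(dec n x, a), (join (dec n x) (dec n b), - a)]) ms) @
     concat (map (\<lambda>(x, y, a). [(dec n x, a), (dec n y, a), (join (dec n x) (dec n y), - a)]) js) @
     concat (map (\<lambda>(x, a). [(dec n x, - a)]) ps) @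
     concat (map (\<lambda>(x, a). [(dec n x, a)]) qs)"

text \<open>A leaf is a dual solution of the linear relaxation: its moves are multiples of the valid
  inequalities \<open>[x] \<le> [x \<union> b]\<close>, \<open>[x] + [y] \<le> 1 + [x \<union> y]\<close>, \<open>[x] = 1\<close> and \<open>[x] = 0\<close>
  between the indicators of the family. Scores are integers, so a bound above \<open>-1\<close>
  (above \<open>-k\<close> after scaling by \<open>k\<close>) is enough.\<close>

fun check :: "int list \<Rightarrow> int list \<Rightarrow> int list \<Rightarrow> int list \<Rightarrow> cert \<Rightarrow> bool" where
  "check T cs ins outs (Split x c d) \<longleftrightarrow>
     check T cs (x # ins) outs c \<and> check T cs ins (x # outs) d"
| "check T cs ins outs (Leaf k ms js ps qs) \<longleftrightarrow>
     list_all (\<lambda>(x, b, a). List.member T b \<and> 0 \<le> a) ms \<and>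
     list_all (\<lambda>(x, y, a). 0 \<le> a) js \<and>
     list_all (\<lambda>(x, a). List.member ins x) ps \<and>
     list_all (\<lambda>(x, a). List.member outs x) qs \<and>
     0 < k \<and> 0 < k + sum_list (map snd ps) - sum_list (map (snd \<circ> snd) js) +
         neg_part (add_all (changes (length cs) ms js ps qs) (scores (map ((*) k) cs) 0))"

text \<open>At a leaf, the changes raise the scaled total by at most the constants of the
  inequalities, while the changed total is at least \<open>neg_part\<close>. Together this keeps the
  scaled total above \<open>- k\<close>. A split is a case distinction on membership.\<close>

lemma check_sound:
  assumes "check T cs ins outs c" and P: "absorbing (length cs) (map (dec (length cs)) T) P"
    and "\<forall>x\<in>set ins. P (dec (length cs) x)" "\<forall>x\<in>set outs. \<not> P (dec (length cs) x)"
  shows "0 \<le> total P (scores cs 0)"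
  using assms(1,3,4)
proof (induction c arbitrary: ins outs)
  case (Split x c d)
  show ?case
  proof (cases "P (dec (length cs) x)")
    case True
    then show ?thesis using Split.IH(1)[of "x # ins" outs] Split.prems by simp
  next
    case False
    then show ?thesis using Split.IH(2)[of ins "x # outs"] Split.prems by simp
  qed
next
  case (Leaf k ms js ps qs)
  let ?n = "length cs"
  let ?t = "scores (map ((*) k) cs) 0"
  have chk: "\<forall>(x, b, a)\<in>set ms. b \<in> set T \<and> 0 \<le> a" "\<forall>(x, y, a)\<in>set js. 0 \<le> a"
    "\<forall>(x, a)\<in>set ps. x \<in> set ins" "\<forall>(x, a)\<in>set qs. x \<in> set outs"
    "0 < k" "0 < k + sum_list (map snd ps) - sum_list (map (snd \<circ> snd) js) +
       neg_part (add_all (changes ?n ms js ps qs) ?t)"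
    using Leaf.prems(1) by (simp_all add: list_all_iff)
  have neg_snd: "(\<Sum>m\<leftarrow>ps. - snd m) = - sum_list (map snd ps)" by (induction ps) auto
  have joinP: "P (join x y)" if "P x" "P y" "length x = ?n" "length y = ?n" for x y
    using P that by (simp add: absorbing_def)
  have joinT: "P (join x (dec ?n b))" if "P x" "length x = ?n" "b \<in> set T" for x b
    using P that by (simp add: absorbing_def)
  have "gain P (concat (map (\<lambda>(x, b, a). [(dec ?n x, a), (join (dec ?n x) (dec ?n b), - a)]) ms))
      \<le> sum_list (map (\<lambda>_. 0) ms)"
  proof (rule gain_concat_le)
    fix m assume "m \<in> set ms"
    moreover obtain x b a where "m = (x, b, a)" by (cases m) auto
    ultimately show "gain P ((\<lambda>(x, b, a). [(dec ?n x, a), (join (dec ?n x) (dec ?n b), - a)]) m) \<le> 0"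
      using chk(1) joinT[of "dec ?n x" b] by auto
  qed
  moreover have "gain P (concat (map (\<lambda>(x, y, a).
        [(dec ?n x, a), (dec ?n y, a), (join (dec ?n x) (dec ?n y), - a)]) js))
      \<le> sum_list (map (snd \<circ> snd) js)"
  proof (rule gain_concat_le)
    fix m assume "m \<in> set js"
    moreover obtain x y a where "m = (x, y, a)" by (cases m) auto
    ultimately show "gain P ((\<lambda>(x, y, a).
        [(dec ?n x, a), (dec ?n y, a), (join (dec ?n x) (dec ?n y), - a)]) m) \<le> (snd \<circ> snd) m"
      using chk(2) joinP[of "dec ?n x" "dec ?n y"] by auto
  qed
  \<comment> \<open>Membership is known exactly in this group and the next, so each entry is an
    equality and its multiplier may have either sign.\<close>
  moreover have "gain P (concat (map (\<lambda>(x, a). [(dec ?n x, - a)]) ps)) \<le> sum_list (map (\<lambda>m. - snd m) ps)"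
  proof (rule gain_concat_le)
    fix m assume "m \<in> set ps"
    moreover obtain x a where "m = (x, a)" by (cases m) auto
    ultimately show "gain P ((\<lambda>(x, a). [(dec ?n x, - a)]) m) \<le> - snd m"
      using chk(3) Leaf.prems(2) by auto
  qed
  moreover have "gain P (concat (map (\<lambda>(x, a). [(dec ?n x, a)]) qs)) \<le> sum_list (map (\<lambda>_. 0) qs)"
  proof (rule gain_concat_le)
    fix m assume "m \<in> set qs"
    moreover obtain x a where "m = (x, a)" by (cases m) auto
    ultimately show "gain P ((\<lambda>(x, a). [(dec ?n x, a)]) m) \<le> 0"
      using chk(4) Leaf.prems(3) by auto
  qed
  ultimately have "gain P (changes ?n ms js ps qs) \<le> sum_list (map (snd \<circ> snd) js) - sum_list (map snd ps)"
    unfolding changes_def gain_append by (simp add: neg_snd comp_def)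
  moreover have "total P (add_all (changes ?n ms js ps qs) ?t) =
      total P ?t + gain P (changes ?n ms js ps qs)"
    by (rule total_add_all[where n = ?n])
      (use full_scores[of "map ((*) k) cs" 0] in \<open>auto simp: changes_def\<close>)
  moreover have "total P ?t = k * total P (scores cs 0)"
    using total_scores_scaled[of P k cs 0] by simp
  ultimately have "- k < k * total P (scores cs 0)"
    using chk(6) neg_part_le_total[of "add_all (changes ?n ms js ps qs) ?t" P] by linarith
  then have "- 1 < total P (scores cs 0)"
    using chk(5) by (metis mult_less_cancel_left_pos mult_minus1_right)
  then show ?case by simp
qed

lemma nonneg_scoresI:
  "check T cs [] [] c \<Longrightarrow> nonneg_scores (map (dec (length cs)) T) cs"
  using check_sound by (fastforce simp: nonneg_scores_def)

subsection \<open>Unavoidable configurations\<close>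

text \<open>A pair \<open>(r, T)\<close> is a configuration of sets on \<open>r\<close> abstract
  points, and \<open>ps\<close> places it in \<open>V\<close>. The placement condition is vacuous
  for \<open>T = []\<close>, so that \<open>(card V, [])\<close> expresses the goal for a finite
  \<open>V\<close>.\<close>

definition forces_FC :: "'a set \<Rightarrow> 'a set set \<Rightarrow> nat \<times> int list \<Rightarrow> bool" where
  "forces_FC V S = (\<lambda>(r, T). \<forall>ps. distinct ps \<longrightarrow> length ps = r \<longrightarrow> set ps \<subseteq> V \<longrightarrow>
     (\<forall>t\<in>set T. set (sel ps (dec r t)) \<in> S) \<longrightarrow> FC_family (generated S))"

text \<open>The third condition says that the sets of \<open>T\<close> cover all indices, which puts
  every weighted point into the union of the generators.\<close>

definition certified :: "int list \<times> int list \<times> cert \<Rightarrow> bool" where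
  "certified = (\<lambda>(cs, T, c).
     list_all ((\<le>) 0) cs \<and> 0 < sum_list cs \<and>
     list_all (\<lambda>i. list_ex (\<lambda>t. dec (length cs) t ! i) T) [0..<length cs] \<and>
     check T cs [] [] c)"

lemma nth_in_sel: "length bs = length ps \<Longrightarrow> i < length ps \<Longrightarrow> bs ! i \<Longrightarrow> ps ! i \<in> set (sel ps bs)"
proof (induction ps arbitrary: bs i)
  case (Cons p ps)
  then show ?case by (cases bs; cases i) auto
qed simp

lemma certified_forces_FC:
  assumes "finite_family S" "certified (cs, T, c)"
  shows "forces_FC V S (length cs, T)"
  unfolding forces_FC_def
proof (clarify)
  fix ps assume ps: "distinct ps" "length ps = length cs" "\<forall>t\<in>set T. set (sel ps (dec (length cs) t)) \<in> S"
  have c: "list_all ((\<le>) 0) cs" "0 < sum_list cs" "check T cs [] [] c"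
    "list_all (\<lambda>i. list_ex (\<lambda>t. dec (length cs) t ! i) T) [0..<length cs]"
    using assms(2) by (auto simp: certified_def)
  show "FC_family (generated S)"
  proof (rule weighted_criterion[OF assms(1) ps(1)])
    show "set ps \<subseteq> \<Union>S"
    proof
      fix p assume "p \<in> set ps"
      then obtain i where i: "i < length cs" "p = ps ! i"
        using ps(2) by (metis in_set_conv_nth)
      then obtain t where "t \<in> set T" "dec (length cs) t ! i"
        using c(4) by (force simp: list_all_iff list_ex_iff)
      then show "p \<in> \<Union>S" using i ps nth_in_sel[of "dec (length cs) t" ps i] by auto
    qed
    show "nonneg_scores (map (dec (length cs)) T) cs" by (rule nonneg_scoresI[OF c(3)])
  qed (use ps c in \<open>auto simp: list_all_iff\<close>)
qed

section \<open>Chaining configurations through a table\<close>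

fun layer :: "nat \<Rightarrow> nat \<Rightarrow> bool list list" where
  "layer 0 0 = [[]]"
| "layer 0 (Suc k) = []"
| "layer (Suc n) 0 = map ((#) False) (layer n 0)"
| "layer (Suc n) (Suc k) = map ((#) True) (layer n k) @ map ((#) False) (layer n (Suc k))"

lemma in_layer: "bs \<in> set (layer (length bs) (length (filter id bs)))"
proof (induction bs)
  case (Cons b bs)
  then show ?case by (cases b; cases "length (filter id bs)") (auto simp: id_def)
qed simp

text \<open>The image of the set coded by \<open>t\<close> under the index map that sends
  \<open>i\<close> to \<open>q ! i\<close>, as a code of length \<open>n\<close>.\<close>

definition relabel :: "nat \<Rightarrow> nat list \<Rightarrow> int \<Rightarrow> bool list" where
  "relabel n q t = (let I = sel q (dec (length q) t) in map (\<lambda>i. List.member I i) [0..<n])"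

definition extension_ok :: "nat \<Rightarrow> (nat \<times> int list) list \<Rightarrow> int list \<Rightarrow> int \<times> nat \<times> nat list \<Rightarrow> bool" where
  "extension_ok n D G = (\<lambda>(x, j, q).
     distinct q \<and> list_all (\<lambda>i. i < n) q \<and> j < length D \<and> fst (D ! j) = length q \<and>
     (let H = map (dec n) (x # G) in list_all (\<lambda>t. List.member H (relabel n q t)) (snd (D ! j))))"

definition few_missed :: "nat \<Rightarrow> nat \<Rightarrow> nat \<Rightarrow> int list \<Rightarrow> bool" where
  "few_missed n k m xs \<longleftrightarrow>
     (let H = map (dec n) xs in length (filter (\<lambda>bs. \<not> List.member H bs) (layer n k)) < m)"

text \<open>\<open>G\<close> lists edges already found. At most \<open>m - 1\<close> sets are missed by the extensions \<open>(x, j, q)\<close>, so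
  one of the \<open>m\<close> edges is some \<open>x\<close>, and \<open>q\<close> embeds the earlier configuration \<open>j\<close> into \<open>x # G\<close>.\<close>

fun table_ok ::
  "nat \<Rightarrow> nat \<Rightarrow> nat \<Rightarrow> (nat \<times> int list) list \<Rightarrow> (int list \<times> (int \<times> nat \<times> nat list) list) list \<Rightarrow> bool"
where
  "table_ok n k m D [] \<longleftrightarrow> True"
| "table_ok n k m D ((G, es) # tab) \<longleftrightarrow>
     few_missed n k m (map fst es) \<and> list_all (extension_ok n D G) es \<and>
     table_ok n k m (D @ [(n, G)]) tab"

lemma set_sel_nth:
  assumes "I \<subseteq> {..<length ps}"
  shows "set (sel ps (map (\<lambda>i. i \<in> I) [0..<length ps])) = (!) ps ` I"
proof -
  have "sel ps (map (\<lambda>i. i \<in> I) [0..<length ps]) =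
      sel (map ((!) ps) [0..<length ps]) (map (\<lambda>i. i \<in> I) [0..<length ps])"
    by (simp only: map_nth)
  also have "\<dots> = map ((!) ps) (filter (\<lambda>i. i \<in> I) [0..<length ps])"
    by (simp only: sel_map sel_member)
  finally show ?thesis using assms by auto
qed

lemma set_sel_relabel:
  assumes "list_all (\<lambda>i. i < length ps) q"
  shows "set (sel ps (relabel (length ps) q t)) = set (sel (map ((!) ps) q) (dec (length q) t))"
proof -
  have "set (sel q (dec (length q) t)) \<subseteq> {..<length ps}"
    using assms sel_subset[of q] by (auto simp: list_all_iff)
  from set_sel_nth[OF this] show ?thesis
    by (simp add: relabel_def Let_def sel_map)
qed

text \<open>Pigeonhole: if no extension \<open>x\<close> were present, \<open>S\<close> would
  consist of missed \<open>k\<close>-sets only, and there are fewer than \<open>m\<close> of these.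
  Some \<open>x\<close> is therefore present, and together with \<open>G\<close> it contains a copy
  of an earlier configuration, which already forces FC.\<close>

lemma forces_FC_step:
  assumes V: "finite V" "card V = n" and S: "S \<subseteq> {X. X \<subseteq> V \<and> card X = k}" "card S = m"
    and D: "\<forall>d\<in>set D. forces_FC V S d"
    and few: "few_missed n k m (map fst es)" and ext: "list_all (extension_ok n D G) es"
  shows "forces_FC V S (n, G)"
  unfolding forces_FC_def
proof clarify
  fix ps assume ps: "distinct ps" "n = length ps" "set ps \<subseteq> V" "\<forall>t\<in>set G. set (sel ps (dec (length ps) t)) \<in> S"
  \<comment> \<open>As \<open>n\<close> is the size of \<open>V\<close>, the list exhausts
    \<open>V\<close>, and each member of \<open>S\<close> has a code in the layer.\<close>
  have psV: "set ps = V"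
    using V ps by (metis card_subset_eq distinct_card)
  have "\<exists>e\<in>set es. set (sel ps (dec n (fst e))) \<in> S"
  proof (rule ccontr)
    assume none: "\<not> ?thesis"
    let ?L = "filter (\<lambda>bs. \<not> List.member (map (dec n) (map fst es)) bs) (layer n k)"
    have "X \<in> (\<lambda>bs. set (sel ps bs)) ` set ?L" if "X \<in> S" for X
    proof -
      let ?bs = "map (\<lambda>p. p \<in> X) ps"
      have X: "X \<subseteq> set ps" "card X = k" using S(1) that psV by auto
      have eq: "set (sel ps ?bs) = X" using X by (auto simp: sel_member)
      have "length (filter id ?bs) = card (X \<inter> set ps)"
        using ps(1) by (simp add: filter_map comp_def distinct_card[symmetric] Int_def conj_commute)
      also have "X \<inter> set ps = X" using X by blast
      finally have "?bs \<in> set (layer n k)"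
        using in_layer[of ?bs] X(2) ps(2) by (metis length_map)
      moreover have "?bs \<notin> set (map (dec n) (map fst es))"
        using none eq that by auto
      ultimately show ?thesis using eq by force
    qed
    then have "card S \<le> card ((\<lambda>bs. set (sel ps bs)) ` set ?L)"
      by (intro card_mono) auto
    also have "\<dots> \<le> length ?L" using card_image_le card_length order_trans by blast
    also have "\<dots> < m" using few by (simp add: few_missed_def Let_def)
    finally show False using S(2) by simp
  qed
  then obtain x j q where e: "(x, j, q) \<in> set es" and x: "set (sel ps (dec n x)) \<in> S" by force
  from e ext have ok: "distinct q" "list_all (\<lambda>i. i < n) q" "j < length D" "fst (D ! j) = length q"
    "\<forall>t\<in>set (snd (D ! j)). relabel n q t \<in> set (map (dec n) (x # G))"
    unfolding list_all_iff extension_ok_def Let_def by fastforce+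
  let ?ps = "map ((!) ps) q"
  have "forces_FC V S (length q, snd (D ! j))"
    using D ok(3,4) by (metis nth_mem prod.collapse)
  moreover have "distinct ?ps"
    using ok(1,2) ps(1,2) by (auto simp: distinct_map list_all_iff inj_on_def nth_eq_iff_index_eq)
  moreover have "set ?ps \<subseteq> V"
    using ok(2) ps(2,3) by (auto simp: list_all_iff)
  moreover have "set (sel ?ps (dec (length q) t)) \<in> S" if "t \<in> set (snd (D ! j))" for t
  proof -
    have "set (sel ?ps (dec (length q) t)) = set (sel ps (relabel n q t))"
      using set_sel_relabel[of ps q t] ok(2) ps(2) by simp
    then show ?thesis using ok(5) that x ps(2,4) by auto
  qed
  ultimately show "FC_family (generated S)" by (auto simp: forces_FC_def)
qed

text \<open>Each row, once established, is appended at the end of \<open>D\<close>, so the indices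
  by which later rows refer to earlier configurations stay fixed.\<close>

lemma table_forces_FC:
  assumes V: "finite V" "card V = n" and S: "S \<subseteq> {X. X \<subseteq> V \<and> card X = k}" "card S = m"
    and "\<forall>d\<in>set D. forces_FC V S d" "table_ok n k m D tab" "G \<in> fst ` set tab"
  shows "forces_FC V S (n, G)"
  using assms(5-)
proof (induction tab arbitrary: D)
  case (Cons e tab)
  obtain G' es where e: "e = (G', es)" by (cases e)
  have "forces_FC V S (n, G')"
    by (rule forces_FC_step[OF V S Cons.prems(1)]) (use Cons.prems(2) e in auto)
  then show ?case
    using Cons.prems e Cons.IH[of "D @ [(n, G')]"] by auto
qed simp

text \<open>The certified types start the list of known configurations. The row \<open>[]\<close>
  has no sets to place, so any enumeration of \<open>V\<close> meets its condition.\<close>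

lemma all_generate_FC:
  assumes "list_all certified types"
    and "table_ok n k m (map (\<lambda>(cs, T, c). (length cs, T)) types) tab" "[] \<in> fst ` set tab"
    and V: "finite V" "card V = n" and S: "S \<subseteq> {X. X \<subseteq> V \<and> card X = k}" "card S = m"
  shows "FC_family (generated S)"
proof -
  obtain ps where ps: "set ps = V" "distinct ps" using finite_distinct_list[OF V(1)] by blast
  have "finite_family S"
    using S(1) V(1) finite_subset[of S "Pow V"] by (auto simp: finite_family_def intro: finite_subset)
  then have "forces_FC V S (n, [])"
    using assms(1)
    by (intro table_forces_FC[OF V S _ assms(2,3)]) (auto simp: list_all_iff intro: certified_forces_FC)
  then show ?thesis
    using ps V(2) by (auto simp: forces_FC_def distinct_card)
qed

subsection \<open>Configurations that are not FC\<close>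

text \<open>For \<open>B \<subseteq> Pow M\<close> these are the unions of a member of
  \<open>B\<close> with an arbitrary subset of \<open>M - Q\<close>. At \<open>Q = M\<close> the
  family is \<open>B\<close> itself.\<close>

definition padded :: "'a set \<Rightarrow> 'a set set \<Rightarrow> 'a set \<Rightarrow> 'a set set" where
  "padded M B Q = {X. X \<subseteq> M \<and> (\<exists>t\<in>B. t \<subseteq> X \<and> (X - t) \<inter> Q = {})}"

text \<open>The union of the two base sets serves as base: a point of \<open>X \<union> Y\<close>
  outside \<open>t \<union> u\<close> lies in \<open>X - t\<close> or in \<open>Y - u\<close>, hence
  not in \<open>Q\<close>.\<close>

lemma padded_Un:
  assumes "union_closed B" "X \<in> padded M B Q" "Y \<in> padded M B Q"
  shows "X \<union> Y \<in> padded M B Q"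
proof -
  obtain t u where "t \<in> B" "t \<subseteq> X" "(X - t) \<inter> Q = {}" "u \<in> B" "u \<subseteq> Y" "(Y - u) \<inter> Q = {}"
    using assms(2,3) by (auto simp: padded_def)
  moreover from this have "t \<union> u \<in> B" using assms(1) by (simp add: union_closed_def)
  ultimately show ?thesis
    using assms(2,3) unfolding padded_def by (intro CollectI conjI bexI[of _ "t \<union> u"]) blast+
qed

lemma padded_Un_base:
  assumes "union_closed B" "B \<subseteq> Pow M" "X \<in> padded M B Q" "b \<in> B"
  shows "X \<union> b \<in> padded M B Q"
proof -
  have "b \<in> padded M B Q" using assms(2,4) by (auto simp: padded_def)
  then show ?thesis using padded_Un[OF assms(1,3)] by blast
qed

text \<open>Each set without \<open>x\<close> cancels against the same set with \<open>x\<close>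
  inserted. This is why the copy of \<open>Pow M\<close> costs nothing in the gluing.\<close>

lemma sum_sgn_in_Pow:
  assumes "finite M" "x \<in> M"
  shows "(\<Sum>X\<in>Pow M. sgn_in x X) = 0"
proof -
  let ?N = "Pow (M - {x})"
  have eq: "Pow M = ?N \<union> insert x ` ?N" using Pow_insert[of x "M - {x}"] assms(2)
    by (simp add: insert_absorb)
  have inj: "inj_on (insert x) ?N" by (auto simp: inj_on_def)
  have "(\<Sum>X\<in>Pow M. sgn_in x X) = (\<Sum>X\<in>?N. sgn_in x X) + (\<Sum>X\<in>insert x ` ?N. sgn_in x X)"
    unfolding eq using assms(1) by (intro sum.union_disjoint) auto
  also have "(\<Sum>X\<in>insert x ` ?N. sgn_in x X) = (\<Sum>X\<in>?N. 1)"
    unfolding sum.reindex[OF inj] by simp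
  also have "(\<Sum>X\<in>?N. sgn_in x X) = (\<Sum>X\<in>?N. - 1)"
    by (intro sum.cong) auto
  finally show ?thesis by simp
qed

text \<open>The witness consists of \<open>B\<close>, of all subsets of \<open>M\<close> extended by \<open>N\<close> new points, and, for each of
  the families \<open>padded M B Q\<close>, of a copy extended by all but one of the new points. Two copies
  extended differently have all new points in their unions, so their interaction is harmless.\<close>

lemma not_FC_generated:
  fixes M :: "nat set"
  assumes M: "finite M" and B: "B \<subseteq> Pow M" "{} \<in> B" "union_closed B" and S: "S \<subseteq> B"
    and N: "2 \<le> length Qs"
    and neg: "\<And>x. x \<in> M \<Longrightarrow>
      (\<Sum>X\<in>B. sgn_in x X) + (\<Sum>Q\<leftarrow>Qs. \<Sum>X\<in>padded M B Q. sgn_in x X) < 0"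
  shows "\<not> FC_family (generated S)"
proof
  define N where "N = length Qs"
  have N2: "2 \<le> N" using N by (simp add: N_def)
  obtain k where k: "M \<subseteq> {..<k}" using M by (auto simp: finite_nat_set_iff_bounded subset_eq)
  define W where "W = {k..<k + N}"
  \<comment> \<open>Indices below \<open>N\<close> are the padded copies, \<open>N\<close> is the
    layer of all subsets of \<open>M\<close>, and \<open>Suc N\<close> is \<open>B\<close> with no
    new points.\<close>
  define Y where "Y = (\<lambda>i. if i < N then W - {k + i} else if i = N then W else {})"
  define F where "F = (\<lambda>i. if i < N then padded M B (Qs ! i) else if i = N then Pow M else B)"
  define A where "A = (\<Union>i\<in>{..Suc N}. (\<lambda>X. X \<union> Y i) ` F i)"
  have F_Pow: "F i \<subseteq> Pow M" for i using B(1) by (auto simp: F_def padded_def)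
  have finF: "finite (F i)" for i using F_Pow M finite_subset by blast
  have MY: "M \<inter> Y i = {}" for i using k by (auto simp: Y_def W_def)
  have Y_inj: "i = j" if "i \<le> Suc N" "j \<le> Suc N" "Y i = Y j" for i j
  proof -
    have mem: "k + a \<in> Y i \<longleftrightarrow> a < N \<and> i \<le> N \<and> a \<noteq> i" if "i \<le> Suc N" for i a
      using that by (auto simp: Y_def W_def)
    have "i \<le> N \<and> a \<noteq> i \<longleftrightarrow> j \<le> N \<and> a \<noteq> j" if "a < N" for a
      using mem[of i a] mem[of j a] that \<open>i \<le> Suc N\<close> \<open>j \<le> Suc N\<close> \<open>Y i = Y j\<close> by simp
    \<comment> \<open>With at least two new points, \<open>W\<close> minus one point is not empty
      and hence differs from the part of index \<open>Suc N\<close>.\<close>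
    from this[of i] this[of j] this[of 0] this[of 1] show ?thesis
      using N2 that(1,2) by presburger
  qed
  have part: "X = X' \<and> Y i = Y j" if "X \<union> Y i = X' \<union> Y j" "X \<in> F i" "X' \<in> F j" for X X' i j
  proof -
    have "X \<subseteq> M" "X' \<subseteq> M" using F_Pow[of i] F_Pow[of j] that(2,3) by auto
    then have "(X \<union> Y i) \<inter> M = X" "(X' \<union> Y j) \<inter> M = X'" "(X \<union> Y i) - M = Y i" "(X' \<union> Y j) - M = Y j"
      using MY[of i] MY[of j] by blast+
    then show ?thesis using that(1) by metis
  qed
  have closed: "\<exists>l\<le>Suc N. Y i \<union> Y j = Y l \<and> X \<union> X' \<in> F l"
    if "i \<le> Suc N" "j \<le> Suc N" "X \<in> F i" "X' \<in> F j" for i j X X'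
  proof -
    have base: "Z \<union> b \<in> F l" if "Z \<in> F l" "b \<in> B" for Z b l
      using that B padded_Un_base[of B M Z _ b] by (auto simp: F_def union_closed_def split: if_splits)
    have same: "Z \<union> Z' \<in> F l" if "Z \<in> F l" "Z' \<in> F l" for Z Z' l
      using that B padded_Un[of B Z M _ Z'] by (auto simp: F_def union_closed_def split: if_splits)
    consider "i = Suc N" | "j = Suc N" | "i = j" | "i \<le> N" "j \<le> N" "i \<noteq> j"
      using \<open>i \<le> Suc N\<close> \<open>j \<le> Suc N\<close> by linarith
    then show ?thesis
    proof cases
      case 1
      then show ?thesis
        using that base[of X' j X] by (intro exI[of _ j]) (auto simp: F_def Y_def Un_commute)
    next
      case 2
      then show ?thesis
        using that base[of X i X'] by (intro exI[of _ i]) (auto simp: F_def Y_def)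
    next
      case 3
      then show ?thesis using that same by blast
    next
      case 4
      then have "Y i \<union> Y j = Y N" by (auto simp: Y_def)
      moreover have "X \<union> X' \<in> F N" using that F_Pow[of i] F_Pow[of j] by (auto simp: F_def)
      ultimately show ?thesis by (intro exI[of _ N]) simp
    qed
  qed
  have "union_closed A"
    unfolding union_closed_def
  proof (intro ballI)
    fix U U' assume "U \<in> A" "U' \<in> A"
    then obtain i j X X' where "i \<le> Suc N" "j \<le> Suc N" "X \<in> F i" "X' \<in> F j"
      "U = X \<union> Y i" "U' = X' \<union> Y j" by (auto simp: A_def)
    moreover from closed[OF this(1-4)] obtain l where "l \<le> Suc N" "Y i \<union> Y j = Y l" "X \<union> X' \<in> F l"
      by blast
    ultimately have "U \<union> U' = (X \<union> X') \<union> Y l" by blast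
    with \<open>X \<union> X' \<in> F l\<close> \<open>l \<le> Suc N\<close> show "U \<union> U' \<in> A" unfolding A_def by blast
  qed
  moreover have "B \<subseteq> A"
    unfolding A_def by (rule subset_trans[OF _ UN_upper[of "Suc N"]]) (auto simp: F_def Y_def)
  moreover have "finite_family A"
  proof -
    have "finite (Y i)" for i by (auto simp: Y_def W_def)
    moreover have "finite X" if "X \<in> F i" for X i
      using that F_Pow[of i] M finite_subset by blast
    ultimately show ?thesis
      using finF by (auto simp: A_def finite_family_def)
  qed
  moreover have "generated S \<subseteq> B"
    by (rule generated_minimal) (use S B in auto)
  moreover assume "FC_family (generated S)"
  \<comment> \<open>The largest set of \<open>generated S\<close> belongs to \<open>B\<close>, hence
    lies within \<open>M\<close>, and so does the frequent point.\<close>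
  ultimately obtain x where x: "x \<in> M" "card A \<le> 2 * card {X \<in> A. x \<in> X}"
    using B(1) unfolding FC_family_def FC_family_of_def by (meson PowD in_mono order_trans)
  have finA: "finite A" using finF by (simp add: A_def)
  have "(\<Sum>X\<in>A. sgn_in x X) = (\<Sum>i\<le>Suc N. \<Sum>X\<in>(\<lambda>X. X \<union> Y i) ` F i. sgn_in x X)"
    unfolding A_def
  proof (rule sum.UNION_disjoint)
    show "\<forall>i\<in>{..Suc N}. \<forall>j\<in>{..Suc N}. i \<noteq> j \<longrightarrow>
        (\<lambda>X. X \<union> Y i) ` F i \<inter> (\<lambda>X. X \<union> Y j) ` F j = {}"
    proof (intro ballI impI equals0I)
      fix i j U assume "i \<in> {..Suc N}" "j \<in> {..Suc N}" "i \<noteq> j"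
        and "U \<in> (\<lambda>X. X \<union> Y i) ` F i \<inter> (\<lambda>X. X \<union> Y j) ` F j"
      moreover from this obtain X X' where "X \<in> F i" "X' \<in> F j" "X \<union> Y i = X' \<union> Y j" by blast
      ultimately show False using part[of X i X' j] Y_inj[of i j] by simp
    qed
  qed (use finF in auto)
  also have "\<dots> = (\<Sum>i\<le>Suc N. \<Sum>X\<in>F i. sgn_in x X)"
  proof (rule sum.cong[OF refl])
    fix i
    have "inj_on (\<lambda>X. X \<union> Y i) (F i)" using part by (auto simp: inj_on_def)
    moreover have "x \<notin> Y i" using MY x(1) by blast
    ultimately show "(\<Sum>X\<in>(\<lambda>X. X \<union> Y i) ` F i. sgn_in x X) = (\<Sum>X\<in>F i. sgn_in x X)"
      by (simp add: sum.reindex)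
  qed
  also have "\<dots> = (\<Sum>i<N. \<Sum>X\<in>F i. sgn_in x X) + (\<Sum>X\<in>Pow M. sgn_in x X) + (\<Sum>X\<in>B. sgn_in x X)"
    by (simp add: lessThan_Suc_atMost[symmetric] F_def)
  also have "(\<Sum>i<N. \<Sum>X\<in>F i. sgn_in x X) = (\<Sum>Q\<leftarrow>Qs. \<Sum>X\<in>padded M B Q. sgn_in x X)"
    by (simp add: F_def N_def sum_list_sum_nth atLeast0LessThan)
  finally have "(\<Sum>X\<in>A. sgn_in x X) < 0"
    using neg[OF x(1)] sum_sgn_in_Pow[OF M x(1)] by simp
  then show False using x(2) by (simp add: sum_sgn_in[OF finA])
qed

section \<open>Evaluating padded families on codes\<close>

fun fits :: "bool list \<Rightarrow> bool list \<Rightarrow> bool list \<Rightarrow> bool" where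
  "fits (q # qs) (x # xs) (t # ts) \<longleftrightarrow> (if t then x else q \<longrightarrow> \<not> x) \<and> fits qs xs ts"
| "fits qs xs ts \<longleftrightarrow> True"

text \<open>\<open>fits\<close> decides bit by bit the condition in \<open>padded\<close>; its
  arguments code \<open>Q\<close>, \<open>X\<close> and \<open>t\<close>, in this order.\<close>

lemma fits_iff:
  assumes "distinct ps" "length qs = length ps" "length xs = length ps" "length ts = length ps"
  shows "fits qs xs ts \<longleftrightarrow> set (sel ps ts) \<subseteq> set (sel ps xs) \<and>
           (set (sel ps xs) - set (sel ps ts)) \<inter> set (sel ps qs) = {}"
  using assms
proof (induction ps arbitrary: qs xs ts)
  case (Cons p ps)
  obtain q qs' x xs' t ts' where "qs = q # qs'" "xs = x # xs'" "ts = t # ts'"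
    using Cons.prems by (cases qs; cases xs; cases ts) auto
  moreover have "p \<notin> set (sel ps cs)" for cs using Cons.prems(1) sel_subset by fastforce
  ultimately show ?case using Cons by (auto split: if_splits)
qed simp

lemma total_cong_length:
  "full n t \<Longrightarrow> (\<And>bs. length bs = n \<Longrightarrow> P bs = Q bs) \<Longrightarrow> total P t = total Q t"
proof (induction n arbitrary: t P Q)
  case (Suc n)
  then obtain l r where t: "t = Node l r" "full n l" "full n r" by auto
  have "total (\<lambda>bs. P (b # bs)) s = total (\<lambda>bs. Q (b # bs)) s" if "full n s" for b s
    by (rule Suc.IH[OF that]) (simp add: Suc.prems(2))
  then show ?case using t by simp
qed auto

definition padded_score :: "bool list list \<Rightarrow> int list \<Rightarrow> bool list \<Rightarrow> int" where
  "padded_score T u q = total (\<lambda>bs. list_ex (fits q bs) T) (scores u 0)"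

lemma weight_unit:
  "distinct ps \<Longrightarrow> weight ps (map (\<lambda>p. if p = x then 1 else 0) ps) X = (if x \<in> set ps then sgn_in x X else 0)"
  by (induction ps) auto

text \<open>Padded sets lie within \<open>set ps\<close>, so they form the single fibre over the
  empty set. A unit weight vector at \<open>x\<close> turns the score into
  \<open>sgn_in x\<close>.\<close>

lemma sum_padded:
  assumes "distinct ps" "x \<in> set ps" "\<forall>t\<in>set T. length t = length ps" "length q = length ps"
  shows "(\<Sum>X\<in>padded (set ps) ((\<lambda>t. set (sel ps t)) ` set T) (set (sel ps q)). sgn_in x X) =
    padded_score T (map (\<lambda>p. if p = x then 1 else 0) ps) q"
proof -
  let ?F = "padded (set ps) ((\<lambda>t. set (sel ps t)) ` set T) (set (sel ps q))"
  let ?u = "map (\<lambda>p. if p = x then 1 else 0) ps"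
  have sub: "?F \<subseteq> Pow (set ps)" by (auto simp: padded_def)
  then have "(\<Sum>X\<in>?F. sgn_in x X) = (\<Sum>X | X \<in> ?F \<and> X - set ps = {}. 0 + weight ps ?u X)"
    using assms(1,2) by (intro sum.cong) (auto simp: weight_unit)
  also have "\<dots> = total (\<lambda>bs. set (sel ps bs) \<union> {} \<in> ?F) (scores ?u 0)"
    by (rule sum_weight_fibre) (use assms(1) sub finite_subset in \<open>auto simp: finite_subset\<close>)
  also have "\<dots> = padded_score T ?u q"
    unfolding padded_score_def
  proof (rule total_cong_length)
    show "full (length ps) (scores ?u 0)" using full_scores[of ?u 0] by simp
    fix bs :: "bool list" assume "length bs = length ps"
    then show "(set (sel ps bs) \<union> {} \<in> ?F) = list_ex (fits q bs) T"
      using assms fits_iff[of ps q bs] sel_subset[of ps bs] by (auto simp: padded_def list_ex_iff)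
  qed
  finally show ?thesis .
qed

text \<open>A checkable form of the hypotheses for gluing: \<open>T\<close> codes the family
  \<open>B\<close>, and \<open>qs\<close> pairs codes of sets \<open>Q\<close> with numbers of
  copies. The all-\<open>True\<close> code stands for the whole ground set and yields the
  contribution of \<open>B\<close>.\<close>

definition deficient :: "nat list \<Rightarrow> int list \<Rightarrow> (int \<times> nat) list \<Rightarrow> bool" where
  "deficient ps T qs \<longleftrightarrow>
     distinct ps \<and> 2 \<le> sum_list (map snd qs) \<and>
     (let n = length ps; U = map (dec n) T in
       List.member U (replicate n False) \<and>
       list_all (\<lambda>t. list_all (\<lambda>u. List.member U (join t u)) U) U \<and>
       list_all (\<lambda>x. let u = map (\<lambda>p. if p = x then 1 else 0) ps in
         padded_score U u (replicate n True) +
         sum_list (map (\<lambda>(q, m). int m * padded_score U u (dec n q)) qs) < 0) ps)"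

lemma sel_replicate: "sel ps (replicate (length ps) b) = (if b then ps else [])"
  by (induction ps) auto

lemma deficient_not_FC:
  assumes "deficient ps T qs" "length ps = n" "S \<subseteq> (\<lambda>t. set (sel ps (dec n t))) ` set T"
  shows "\<not> FC_family (generated S)"
proof -
  let ?n = "length ps"
  let ?U = "map (dec ?n) T"
  let ?B = "(\<lambda>t. set (sel ps t)) ` set ?U"
  let ?u = "\<lambda>x. map (\<lambda>p. if p = x then 1 else 0) ps"
  have d: "distinct ps" "2 \<le> sum_list (map snd qs)" "replicate ?n False \<in> set ?U"
    "\<forall>t\<in>set ?U. \<forall>u\<in>set ?U. join t u \<in> set ?U"
    "\<forall>x\<in>set ps. padded_score ?U (?u x) (replicate ?n True) +
         sum_list (map (\<lambda>(q, m). int m * padded_score ?U (?u x) (dec ?n q)) qs) < 0"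
    using assms(1) by (simp_all add: deficient_def Let_def list_all_iff)
  have B: "?B \<subseteq> Pow (set ps)" using sel_subset by fastforce
  have len: "\<forall>t\<in>set ?U. length t = length ps" by auto
  let ?Qs = "concat (map (\<lambda>(q, m). replicate m (set (sel ps (dec ?n q)))) qs)"
  show ?thesis
  proof (rule not_FC_generated[OF _ B])
    have "set (sel ps (replicate ?n False)) = {}" by (simp add: sel_replicate)
    then show "{} \<in> ?B" using d(3) by (metis image_eqI)
    show "union_closed ?B"
      unfolding union_closed_def
    proof (intro ballI)
      fix X Y assume "X \<in> ?B" "Y \<in> ?B"
      then obtain t u where "t \<in> set ?U" "u \<in> set ?U" "X = set (sel ps t)" "Y = set (sel ps u)" by blast
      moreover from this have "X \<union> Y = set (sel ps (join t u))" using len set_sel_join[of t ps u] by auto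
      ultimately show "X \<union> Y \<in> ?B" using d(4) by blast
    qed
    show "S \<subseteq> ?B" using assms(2,3) by auto
    have "length ?Qs = sum_list (map snd qs)" by (induction qs) auto
    then show "2 \<le> length ?Qs" using d(2) by simp
    fix x assume x: "x \<in> set ps"
    have "padded (set ps) ?B (set ps) = ?B"
      unfolding padded_def
    proof (intro equalityI subsetI)
      fix X assume "X \<in> {X. X \<subseteq> set ps \<and> (\<exists>t\<in>?B. t \<subseteq> X \<and> (X - t) \<inter> set ps = {})}"
      then obtain t where "t \<in> ?B" "t = X" by blast
      then show "X \<in> ?B" by simp
    qed (use B in blast)
    then have "padded (set ps) ?B (set (sel ps (replicate ?n True))) = ?B"
      by (simp only: sel_replicate if_True)
    then have "(\<Sum>X\<in>?B. sgn_in x X) = padded_score ?U (?u x) (replicate ?n True)"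
      using sum_padded[OF d(1) x len, of "replicate ?n True"] by simp
    moreover have "(\<Sum>Q\<leftarrow>?Qs. \<Sum>X\<in>padded (set ps) ?B Q. sgn_in x X) =
        sum_list (map (\<lambda>(q, m). int m * padded_score ?U (?u x) (dec ?n q)) qs)"
      using sum_padded[OF d(1) x len] by (induction qs) (auto simp: sum_list_replicate map_replicate)
    ultimately show "(\<Sum>X\<in>?B. sgn_in x X) + (\<Sum>Q\<leftarrow>?Qs. \<Sum>X\<in>padded (set ps) ?B Q. sgn_in x X) < 0"
      using d(5) x by simp
  qed simp
qed

subsection \<open>The certificates\<close>

text \<open>Found by computer search. A set is written as a bit mask, with bit \<open>i\<close> standing for the point of
  index \<open>i\<close>.\<close>

definition triple_types :: "(int list \<times> int list \<times> cert) list" where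
  "triple_types = [
    ([1, 1, 1, 1], [7, 11, 13],
    Split 0
    (Leaf 1
    [(7, 11, 4), (0, 13, 2), (0, 11, 2), (0, 7, 6)]
    [(2, 12, 2), (4, 8, 2)]
    [(0, 6)] [])
    (Leaf 1
    [(2, 11, 2), (4, 11, 2), (8, 13, 2), (1, 7, 2)]
    []
    [] [(0, 4)])),
    ([4, 3, 3, 2, 2], [7, 19, 13],
    Split 7
    (Leaf 1
    [(16, 19, 2), (4, 13, 4), (0, 19, 2), (16, 13, 8), (24, 19, 2), (8, 19, 6), (15, 19, 14),
     (7, 13, 24), (7, 19, 10)]
    [(2, 9, 2), (1, 10, 2), (6, 24, 2), (4, 10, 2), (12, 18, 4), (2, 20, 2), (1, 24, 2),
     (4, 17, 2), (1, 20, 2)]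
    [(7, 40)] [])
    (Leaf 1
    [(8, 19, 6), (9, 19, 2), (10, 7, 4), (12, 19, 4), (16, 19, 4), (17, 13, 2), (16, 7, 6),
     (20, 7, 4), (24, 13, 6), (8, 7, 4), (18, 13, 4), (6, 7, 2), (4, 7, 8), (2, 7, 8), (1, 7, 6),
     (0, 7, 14)]
    []
    [] [(7, 32)])),
    ([2, 2, 2, 2, 1], [19, 13, 14],
    Split 13
    (Leaf 1
    [(0, 14, 3), (8, 19, 1), (0, 19, 1), (4, 19, 4), (17, 13, 1), (18, 14, 3), (16, 13, 4),
     (25, 19, 1), (24, 19, 2), (9, 19, 1), (20, 19, 1), (16, 14, 2), (13, 14, 7), (13, 19, 9)]
    [(3, 4, 1), (2, 24, 1), (2, 5, 1), (2, 8, 2), (2, 20, 1), (12, 16, 1), (1, 6, 1), (1, 10, 3),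
     (1, 20, 1), (8, 17, 2)]
    [(13, 19)] [])
    (Leaf 1
    [(2, 13, 5), (3, 13, 1), (6, 13, 1), (10, 19, 1), (16, 13, 5), (17, 14, 3), (16, 14, 1),
     (18, 13, 3), (16, 19, 1), (24, 19, 3), (20, 14, 3), (12, 13, 1), (9, 13, 1), (8, 13, 5),
     (5, 13, 1), (4, 13, 5), (1, 13, 5), (0, 13, 9)]
    []
    [] [(13, 24)])),
    ([2, 2, 1, 1, 1, 1], [7, 11, 19, 35],
    Split 7
    (Leaf 1
    [(8, 19, 4), (0, 35, 2), (0, 19, 2), (0, 11, 2), (32, 11, 4), (48, 11, 2), (16, 35, 2),
     (32, 19, 2), (24, 35, 4), (23, 35, 6), (15, 35, 14), (15, 19, 6), (7, 35, 4), (7, 19, 18),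
     (7, 11, 24)]
    [(20, 34, 2), (16, 42, 2), (6, 16, 2), (9, 36, 2), (5, 28, 2), (22, 40, 2), (10, 36, 2),
     (14, 48, 2), (2, 40, 2), (8, 33, 2), (2, 12, 2), (1, 52, 2), (17, 44, 2), (20, 41, 2),
     (1, 56, 2), (12, 18, 2), (23, 47, 8)]
    [(7, 48)] [])
    (Leaf 1
    [(8, 11, 2), (10, 19, 2), (8, 7, 2), (12, 7, 2), (8, 35, 2), (16, 7, 6), (17, 35, 2),
     (24, 35, 2), (20, 11, 4), (9, 19, 2), (24, 7, 2), (18, 19, 2), (28, 35, 2), (12, 35, 2),
     (32, 35, 2), (33, 19, 2), (34, 11, 2), (32, 7, 4), (40, 7, 4), (36, 19, 4), (44, 19, 2),
     (48, 11, 4), (52, 11, 2), (56, 7, 2), (23, 35, 2), (6, 7, 2), (5, 7, 2), (4, 7, 6),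
     (2, 7, 4), (1, 7, 4), (0, 7, 8)]
    []
    [] [(7, 24)])),
    ([1, 1, 1, 1, 1, 1], [41, 49, 14, 22],
    Split 14
    (Split 1
    (Leaf 1
    [(10, 49, 2), (28, 41, 2), (2, 49, 2), (4, 49, 2), (48, 22, 2), (5, 41, 2), (32, 14, 2),
     (40, 22, 2), (2, 41, 2), (41, 49, 6), (23, 49, 4), (1, 22, 6), (1, 14, 2), (1, 41, 6),
     (14, 22, 8), (14, 49, 6), (14, 41, 4)]
    [(3, 57, 2), (4, 57, 2), (9, 18, 2), (8, 20, 2), (12, 17, 2), (6, 33, 2), (16, 34, 2),
     (8, 50, 2), (24, 36, 2), (32, 30, 2), (1, 30, 4)]
    [(1, 14), (14, 18)] [])
    (Leaf 1
    [(0, 49, 4), (49, 22, 4), (3, 14, 2), (4, 49, 2), (9, 22, 2), (10, 49, 2), (12, 49, 2),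
     (5, 22, 2), (17, 14, 2), (20, 41, 2), (24, 41, 2), (40, 22, 2), (2, 49, 2), (32, 22, 2),
     (32, 14, 2), (4, 41, 2), (48, 14, 2), (18, 41, 2), (2, 41, 2), (14, 22, 2), (14, 49, 6),
     (14, 41, 4)]
    [(6, 33, 2), (16, 34, 2), (16, 44, 2), (8, 50, 2), (8, 36, 2)]
    [(14, 12)] [(1, 4)]))
    (Leaf 1
    [(1, 14, 2), (5, 41, 2), (36, 49, 2), (3, 41, 2), (16, 22, 2), (22, 49, 2), (20, 41, 2),
     (1, 22, 2), (9, 22, 2), (24, 41, 2), (32, 22, 2), (33, 14, 2), (32, 14, 2), (40, 22, 2),
     (16, 14, 2), (34, 49, 2), (18, 41, 2), (48, 14, 2), (17, 14, 2), (12, 14, 2), (10, 14, 2),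
     (8, 14, 4), (6, 14, 2), (4, 14, 4), (2, 14, 4), (0, 14, 6)]
    []
    [] [(14, 24)])),
    ([1, 1, 1, 1, 1, 1], [21, 41, 38, 26],
    Split 0
    (Leaf 1
    [(4, 41, 2), (18, 21, 2), (37, 38, 2), (8, 38, 2), (24, 21, 2), (16, 38, 2), (36, 21, 2),
     (35, 41, 2), (11, 26, 2), (32, 26, 2), (4, 26, 2), (25, 41, 2), (38, 41, 4), (26, 38, 4),
     (26, 41, 4), (21, 26, 4), (21, 38, 10), (21, 41, 4), (0, 26, 14), (0, 38, 4), (0, 21, 18)]
    [(2, 33, 2), (3, 12, 2), (16, 34, 2), (1, 10, 2), (20, 40, 2), (1, 50, 2), (9, 17, 2),
     (5, 32, 2), (26, 55, 6)]
    [(0, 30)] [])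
    (Leaf 1
    [(23, 41, 2), (4, 26, 2), (5, 26, 2), (4, 41, 2), (8, 38, 4), (12, 21, 2), (16, 38, 2),
     (17, 38, 2), (18, 41, 2), (1, 26, 2), (3, 41, 2), (24, 38, 2), (6, 41, 2), (33, 26, 2),
     (32, 26, 4), (58, 21, 2), (34, 21, 2), (40, 21, 2), (2, 21, 4), (1, 38, 2), (9, 38, 2),
     (10, 21, 2), (48, 21, 2), (36, 26, 2), (16, 41, 2), (20, 41, 2), (46, 21, 2)]
    []
    [] [(0, 6)]))]"

text \<open>An index \<open>j\<close> below 6 refers to \<open>triple_types\<close>, any other to
  row \<open>j - 6\<close>. The rows descend from three known triples to none.\<close>

definition triple_table :: "(int list \<times> (int \<times> nat \<times> nat list) list) list" where
  "triple_table = [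
    ([7, 11, 19], [(35, 3, [0, 1, 2, 3, 4, 5]), (13, 0, [0, 1, 2, 3]), (21, 0, [0, 1, 2, 4]),
     (37, 1, [0, 1, 2, 5, 3]), (25, 0, [0, 1, 3, 4]), (41, 1, [0, 1, 3, 5, 2]),
     (49, 1, [0, 1, 4, 5, 2]), (14, 0, [1, 0, 2, 3]), (22, 0, [1, 0, 2, 4]),
     (38, 1, [1, 0, 2, 5, 3]), (26, 0, [1, 0, 3, 4]), (42, 1, [1, 0, 3, 5, 2]),
     (50, 1, [1, 0, 4, 5, 2]), (28, 2, [2, 3, 0, 1, 4]), (44, 2, [2, 3, 0, 1, 5]),
     (52, 2, [2, 4, 0, 1, 5]), (56, 2, [3, 4, 0, 1, 5])]),
    ([7, 11, 49], [(19, 1, [0, 1, 4, 5, 2]), (35, 1, [0, 1, 5, 4, 2]), (13, 0, [0, 1, 2, 3]),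
     (21, 1, [0, 1, 2, 4, 3]), (37, 1, [0, 1, 2, 5, 3]), (25, 1, [0, 1, 3, 4, 2]),
     (41, 1, [0, 1, 3, 5, 2]), (14, 0, [1, 0, 2, 3]), (22, 1, [1, 0, 2, 4, 3]),
     (38, 1, [1, 0, 2, 5, 3]), (26, 1, [1, 0, 3, 4, 2]), (42, 1, [1, 0, 3, 5, 2]),
     (50, 2, [0, 1, 4, 5, 2]), (28, 2, [2, 3, 0, 1, 4]), (44, 2, [2, 3, 0, 1, 5]),
     (52, 2, [0, 2, 4, 5, 1]), (56, 2, [0, 3, 4, 5, 1])]),
    ([7, 11, 52], [(19, 2, [2, 4, 0, 1, 5]), (35, 2, [2, 5, 0, 1, 4]), (13, 0, [0, 1, 2, 3]),
     (21, 1, [0, 1, 2, 4, 3]), (37, 1, [0, 1, 2, 5, 3]), (25, 1, [0, 1, 3, 4, 2]),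
     (41, 1, [0, 1, 3, 5, 2]), (49, 2, [0, 2, 4, 5, 1]), (14, 0, [1, 0, 2, 3]),
     (22, 1, [1, 0, 2, 4, 3]), (38, 1, [1, 0, 2, 5, 3]), (26, 1, [1, 0, 3, 4, 2]),
     (42, 1, [1, 0, 3, 5, 2]), (50, 2, [1, 2, 4, 5, 0]), (28, 2, [2, 3, 0, 1, 4]),
     (44, 2, [2, 3, 0, 1, 5]), (56, 4, [0, 4, 5, 2, 3, 1])]),
    ([7, 25, 42], [(11, 1, [0, 1, 3, 4, 2]), (19, 1, [0, 1, 4, 3, 2]), (35, 1, [1, 0, 5, 3, 2]),
     (13, 1, [0, 2, 3, 4, 1]), (21, 1, [0, 2, 4, 3, 1]), (37, 2, [1, 5, 0, 2, 3]),
     (41, 1, [3, 0, 5, 1, 4]), (49, 2, [3, 5, 0, 4, 1]), (14, 1, [1, 2, 3, 5, 0]),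
     (22, 2, [0, 4, 1, 2, 3]), (38, 1, [1, 2, 5, 3, 0]), (26, 1, [3, 1, 4, 0, 5]),
     (50, 2, [3, 4, 1, 5, 0]), (28, 2, [0, 2, 3, 4, 1]), (44, 2, [1, 2, 3, 5, 0]),
     (52, 5, [0, 5, 1, 4, 2, 3]), (56, 1, [3, 4, 5, 1, 0])]),
    ([7, 11], [(35, 6, [0, 1, 2, 3, 5, 4]), (13, 0, [0, 1, 2, 3]), (21, 1, [0, 1, 2, 4, 3]),
     (37, 1, [0, 1, 2, 5, 3]), (25, 1, [0, 1, 3, 4, 2]), (41, 1, [0, 1, 3, 5, 2]),
     (49, 7, [0, 1, 2, 3, 4, 5]), (14, 0, [1, 0, 2, 3]), (22, 1, [1, 0, 2, 4, 3]),
     (38, 1, [1, 0, 2, 5, 3]), (26, 1, [1, 0, 3, 4, 2]), (42, 1, [1, 0, 3, 5, 2]),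
     (50, 7, [1, 0, 2, 3, 4, 5]), (28, 2, [2, 3, 0, 1, 4]), (44, 2, [2, 3, 0, 1, 5]),
     (52, 8, [0, 1, 2, 3, 4, 5]), (56, 8, [0, 1, 3, 2, 4, 5])]),
    ([7, 25], [(11, 1, [0, 1, 3, 4, 2]), (19, 1, [0, 1, 4, 3, 2]), (13, 1, [0, 2, 3, 4, 1]),
     (21, 1, [0, 2, 4, 3, 1]), (37, 7, [0, 2, 1, 5, 3, 4]), (41, 7, [0, 3, 4, 5, 1, 2]),
     (49, 7, [0, 4, 3, 5, 1, 2]), (14, 2, [0, 3, 1, 2, 4]), (22, 2, [0, 4, 1, 2, 3]),
     (38, 8, [1, 2, 0, 5, 3, 4]), (26, 2, [0, 1, 3, 4, 2]), (42, 9, [0, 1, 2, 3, 4, 5]),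
     (50, 9, [0, 1, 2, 4, 3, 5]), (28, 2, [0, 2, 3, 4, 1]), (44, 9, [0, 2, 1, 3, 4, 5]),
     (52, 9, [0, 2, 1, 4, 3, 5]), (56, 8, [3, 4, 0, 5, 1, 2])]),
    ([7], [(19, 10, [0, 1, 2, 4, 3, 5]), (35, 10, [0, 1, 2, 5, 3, 4]),
     (13, 10, [0, 2, 1, 3, 4, 5]), (21, 10, [0, 2, 1, 4, 3, 5]), (37, 10, [0, 2, 1, 5, 3, 4]),
     (25, 11, [0, 1, 2, 3, 4, 5]), (41, 11, [0, 1, 2, 3, 5, 4]), (49, 11, [0, 1, 2, 4, 5, 3]),
     (14, 10, [1, 2, 0, 3, 4, 5]), (22, 10, [1, 2, 0, 4, 3, 5]), (38, 10, [1, 2, 0, 5, 3, 4]),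
     (26, 11, [1, 0, 2, 3, 4, 5]), (42, 11, [1, 0, 2, 3, 5, 4]), (50, 11, [1, 0, 2, 4, 5, 3]),
     (28, 11, [2, 0, 1, 3, 4, 5]), (44, 11, [2, 0, 1, 3, 5, 4]), (52, 11, [2, 0, 1, 4, 5, 3])]),
    ([], [(35, 12, [0, 1, 5, 2, 3, 4]), (13, 12, [0, 2, 3, 1, 4, 5]),
     (21, 12, [0, 2, 4, 1, 3, 5]), (37, 12, [0, 2, 5, 1, 3, 4]), (25, 12, [0, 3, 4, 1, 2, 5]),
     (41, 12, [0, 3, 5, 1, 2, 4]), (49, 12, [0, 4, 5, 1, 2, 3]), (14, 12, [1, 2, 3, 0, 4, 5]),
     (22, 12, [1, 2, 4, 0, 3, 5]), (38, 12, [1, 2, 5, 0, 3, 4]), (26, 12, [1, 3, 4, 0, 2, 5]),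
     (42, 12, [1, 3, 5, 0, 2, 4]), (50, 12, [1, 4, 5, 0, 2, 3]), (28, 12, [2, 3, 4, 0, 1, 5]),
     (44, 12, [2, 3, 5, 0, 1, 4]), (52, 12, [2, 4, 5, 0, 1, 3]), (56, 12, [3, 4, 5, 0, 1, 2])])]"

text \<open>The complements form, in this order, a star with four edges and a pendant edge, a
  hexagon, and the complete bipartite graph between 2 and 3 points with one edge added on the side
  of 3 points.\<close>

definition quadruple_types :: "(int list \<times> int list \<times> cert) list" where
  "quadruple_types = [
    ([2, 4, 5, 5, 5, 5], [60, 54, 46, 30, 57],
    Split 60
    (Split 1
    (Leaf 2
    [(0, 46, 23), (2, 57, 16), (0, 30, 16), (8, 46, 1), (4, 30, 8), (0, 54, 13), (16, 54, 1),
     (3, 57, 16), (2, 54, 9), (32, 54, 1), (1, 57, 16), (1, 30, 32), (1, 46, 32), (1, 54, 32),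
     (61, 54, 52), (60, 57, 88), (60, 54, 44)]
    [(5, 11, 1), (6, 33, 4), (12, 33, 4), (6, 16, 1), (11, 17, 7), (10, 32, 7), (13, 33, 4),
     (8, 16, 23), (19, 33, 7), (4, 24, 4), (12, 16, 4), (4, 40, 8), (20, 1, 1), (20, 32, 8),
     (4, 49, 4), (9, 34, 4), (17, 34, 5), (3, 41, 4), (9, 36, 8), (5, 48, 3), (9, 19, 1),
     (3, 40, 4), (16, 42, 3), (3, 25, 4), (10, 48, 9), (21, 33, 5), (26, 32, 4), (17, 37, 4),
     (24, 32, 8), (18, 32, 4), (4, 35, 8), (5, 18, 4), (2, 36, 4), (7, 17, 8), (2, 12, 4),
     (5, 24, 16), (6, 9, 11), (2, 20, 3), (8, 18, 8), (24, 34, 7)]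
    [(1, 69), (60, 160)] [])
    (Leaf 2
    [(0, 57, 8), (5, 46, 6), (9, 30, 23), (32, 57, 6), (2, 57, 32), (33, 54, 14), (3, 30, 2),
     (0, 46, 24), (41, 46, 4), (16, 57, 2), (19, 30, 7), (16, 54, 14), (5, 54, 18), (4, 54, 10),
     (0, 30, 20), (2, 30, 4), (3, 46, 22), (61, 54, 52), (60, 57, 88), (60, 54, 44)]
    [(4, 40, 6), (18, 49, 2), (6, 8, 4), (7, 32, 8), (11, 16, 4), (10, 32, 4), (11, 32, 4),
     (6, 9, 1), (13, 16, 4), (12, 32, 2), (12, 33, 10), (24, 34, 8), (8, 48, 8), (20, 32, 8),
     (4, 18, 4), (6, 17, 11), (16, 34, 4), (4, 25, 4), (4, 19, 1), (8, 20, 4), (4, 24, 4),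
     (8, 21, 4), (4, 34, 1), (8, 35, 8), (10, 48, 4), (16, 37, 4), (10, 17, 8), (3, 36, 4),
     (4, 49, 2), (17, 36, 5), (34, 36, 3), (8, 18, 4), (18, 40, 6)]
    [(60, 160)] [(1, 44)]))
    (Leaf 1
    [(1, 54, 4), (2, 57, 4), (3, 60, 6), (37, 46, 2), (6, 60, 8), (2, 46, 10), (9, 57, 8),
     (10, 60, 8), (11, 46, 4), (13, 30, 2), (17, 54, 12), (18, 30, 8), (19, 60, 4), (21, 30, 2),
     (25, 54, 2), (33, 30, 12), (34, 46, 2), (35, 57, 4), (41, 46, 2), (34, 60, 6), (3, 57, 8),
     (49, 46, 2), (1, 60, 18), (9, 46, 4), (5, 30, 12), (2, 54, 4), (7, 46, 4), (48, 60, 6),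
     (40, 60, 6), (36, 60, 6), (32, 60, 16), (24, 60, 6), (20, 60, 6), (16, 60, 16), (12, 60, 6),
     (8, 60, 16), (4, 60, 16), (0, 60, 26)]
    []
    [] [(60, 112)])),
    ([1, 1, 1, 1, 1, 1], [46, 30, 53, 29, 51, 43],
    Split 30
    (Split 0
    (Leaf 1
    [(51, 53, 4), (43, 51, 4), (43, 46, 4), (29, 53, 4), (0, 43, 10), (0, 51, 6), (0, 29, 6),
     (0, 53, 2), (0, 46, 2), (30, 29, 4), (30, 53, 6), (30, 46, 4)]
    [(2, 4, 2), (3, 12, 2), (18, 40, 2), (10, 17, 2), (5, 16, 2), (9, 48, 2), (24, 36, 2),
     (16, 38, 2), (8, 37, 2), (1, 38, 2), (4, 33, 2), (6, 34, 2), (2, 21, 2), (6, 32, 2)]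
    [(0, 20), (30, 16)] [])
    (Leaf 1
    [(1, 29, 2), (4, 43, 4), (2, 53, 4), (8, 46, 2), (8, 53, 2), (24, 53, 1), (40, 53, 1),
     (32, 43, 2), (32, 53, 2), (16, 43, 4), (1, 51, 2), (30, 29, 4), (30, 53, 6), (30, 46, 4)]
    [(17, 40, 1), (3, 12, 1), (10, 48, 1), (5, 18, 2), (12, 48, 1), (6, 33, 2), (9, 36, 2),
     (20, 34, 2), (10, 17, 1), (3, 24, 1)]
    [(30, 16)] [(0, 6)]))
    (Leaf 1
    [(1, 30, 2), (3, 51, 2), (5, 29, 2), (9, 30, 2), (1, 46, 2), (17, 46, 2), (32, 29, 4),
     (33, 53, 2), (34, 29, 2), (36, 43, 2), (40, 51, 2), (48, 46, 2), (24, 30, 2), (20, 30, 2),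
     (18, 30, 2), (16, 30, 4), (12, 30, 2), (10, 30, 2), (8, 30, 4), (6, 30, 2), (4, 30, 4),
     (2, 30, 4), (0, 30, 6)]
    []
    [] [(30, 32)])),
    ([3, 3, 3, 3, 3, 4], [58, 54, 46, 57, 53, 45, 51],
    Split 54
    (Split 0
    (Leaf 1
    [(51, 58, 13), (45, 57, 13), (45, 46, 13), (0, 51, 20), (0, 45, 33), (0, 53, 7), (0, 57, 7),
     (0, 46, 7), (0, 58, 7), (54, 53, 13), (54, 57, 19), (54, 58, 13)]
    [(3, 28, 1), (2, 17, 3), (3, 8, 2), (3, 38, 1), (6, 17, 4), (7, 32, 1), (1, 22, 1),
     (1, 34, 1), (9, 10, 3), (2, 13, 1), (14, 16, 1), (2, 29, 2), (16, 40, 1), (12, 19, 7),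
     (8, 18, 3), (11, 32, 1), (10, 21, 1), (18, 32, 1), (1, 38, 5), (4, 34, 4), (5, 25, 1),
     (24, 36, 1), (4, 33, 1), (10, 33, 3), (6, 36, 2), (1, 18, 3), (5, 24, 6), (8, 36, 1),
     (4, 11, 4), (3, 40, 3), (8, 52, 6), (2, 9, 4), (2, 40, 1), (20, 32, 7), (1, 48, 1),
     (4, 26, 4), (6, 32, 1), (11, 16, 5), (8, 33, 1)]
    [(0, 62), (54, 52)] [])
    (Leaf 1
    [(1, 46, 11), (2, 46, 5), (2, 51, 3), (8, 51, 7), (32, 57, 4), (16, 53, 7), (2, 57, 4),
     (4, 46, 2), (48, 45, 3), (32, 58, 7), (12, 45, 2), (24, 53, 1), (16, 57, 3), (17, 58, 2),
     (4, 57, 9), (9, 46, 2), (18, 51, 4), (8, 45, 5), (54, 53, 13), (54, 57, 19), (54, 58, 13)]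
    [(22, 24, 1), (4, 26, 1), (7, 16, 1), (5, 10, 2), (11, 20, 1), (3, 12, 3), (13, 18, 1),
     (10, 17, 5), (3, 20, 2), (5, 24, 5), (14, 25, 1), (8, 48, 1), (6, 28, 1), (3, 36, 2),
     (12, 18, 2), (6, 33, 5), (16, 34, 1), (16, 36, 1), (1, 36, 1), (4, 19, 1), (9, 40, 1),
     (20, 40, 4), (1, 48, 1), (9, 34, 4), (6, 21, 1), (2, 36, 1)]
    [(54, 52)] [(0, 19)]))
    (Leaf 1
    [(1, 54, 11), (3, 46, 7), (5, 45, 7), (7, 54, 1), (8, 54, 13), (9, 53, 5), (10, 58, 7),
     (11, 58, 1), (13, 57, 1), (14, 57, 1), (17, 45, 7), (19, 54, 1), (21, 53, 1), (9, 54, 2),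
     (25, 58, 1), (26, 53, 1), (28, 51, 1), (33, 58, 2), (40, 57, 5), (12, 46, 7), (1, 58, 2),
     (24, 51, 7), (33, 51, 3), (48, 54, 5), (36, 54, 5), (34, 54, 5), (32, 54, 11), (22, 54, 1),
     (20, 54, 7), (18, 54, 7), (16, 54, 13), (6, 54, 7), (4, 54, 13), (2, 54, 13), (0, 54, 19)]
    []
    [] [(54, 99)]))]"

text \<open>An index \<open>j\<close> below 3 refers to \<open>quadruple_types\<close>, any other to
  row \<open>j - 3\<close>. The rows descend from seven known quadruples to none.\<close>

definition quadruple_table :: "(int list \<times> (int \<times> nat \<times> nat list) list) list" where
  "quadruple_table = [
    ([15, 23, 27, 29, 39, 43, 51], [(45, 2, [4, 5, 2, 3, 1, 0]), (53, 2, [3, 5, 2, 4, 1, 0]),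
     (57, 2, [2, 5, 3, 4, 1, 0]), (30, 0, [5, 2, 3, 0, 1, 4]), (46, 0, [4, 5, 1, 0, 2, 3]),
     (54, 0, [3, 5, 1, 0, 2, 4]), (58, 0, [2, 5, 1, 0, 3, 4]), (60, 0, [5, 1, 0, 2, 3, 4])]),
    ([15, 23, 27, 29, 39, 43, 53], [(51, 2, [3, 5, 2, 4, 1, 0]), (45, 2, [4, 5, 1, 3, 2, 0]),
     (57, 2, [1, 4, 2, 5, 3, 0]), (30, 0, [5, 1, 3, 0, 2, 4]), (46, 0, [4, 3, 1, 0, 2, 5]),
     (54, 0, [3, 4, 2, 0, 1, 5]), (58, 0, [5, 2, 0, 1, 3, 4]), (60, 0, [5, 1, 0, 2, 3, 4])]),
    ([15, 23, 27, 39, 43, 53, 58], [(51, 0, [2, 3, 1, 0, 4, 5]), (29, 0, [5, 2, 0, 1, 3, 4]),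
     (45, 0, [4, 2, 0, 1, 3, 5]), (57, 0, [2, 1, 3, 0, 4, 5]), (30, 0, [5, 3, 1, 0, 2, 4]),
     (46, 0, [4, 3, 1, 0, 2, 5]), (54, 0, [3, 0, 2, 1, 4, 5]), (60, 1, [0, 3, 4, 5, 2, 1])]),
    ([15, 23, 27, 39, 45, 54, 57], [(43, 0, [4, 3, 0, 1, 2, 5]), (51, 0, [3, 2, 1, 0, 4, 5]),
     (29, 0, [5, 3, 0, 1, 2, 4]), (53, 0, [3, 1, 2, 0, 4, 5]), (30, 0, [5, 2, 1, 0, 3, 4]),
     (46, 0, [4, 1, 2, 0, 3, 5]), (58, 1, [0, 1, 5, 4, 3, 2]), (60, 1, [0, 2, 4, 5, 3, 1])]),
    ([15, 23, 27, 39, 45, 57, 58], [(43, 0, [2, 4, 3, 0, 1, 5]), (51, 0, [2, 1, 4, 0, 3, 5]),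
     (29, 0, [5, 2, 0, 1, 3, 4]), (53, 2, [1, 5, 3, 4, 2, 0]), (30, 0, [5, 2, 1, 0, 3, 4]),
     (46, 0, [4, 0, 2, 1, 3, 5]), (54, 1, [0, 1, 5, 4, 3, 2]), (60, 1, [0, 4, 5, 3, 2, 1])]),
    ([15, 23, 27, 45, 46, 53, 54], [(39, 0, [3, 5, 2, 0, 1, 4]), (43, 0, [4, 0, 3, 1, 2, 5]),
     (51, 0, [3, 0, 4, 1, 2, 5]), (29, 0, [5, 3, 0, 1, 2, 4]), (57, 1, [0, 1, 5, 2, 3, 4]),
     (30, 0, [5, 3, 1, 0, 2, 4]), (58, 1, [0, 1, 5, 3, 2, 4]), (60, 2, [3, 4, 0, 1, 5, 2])]),
    ([15, 23, 27, 45, 53, 58, 60], [(39, 1, [0, 3, 5, 4, 2, 1]), (43, 1, [0, 3, 4, 5, 2, 1]),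
     (51, 1, [0, 3, 4, 5, 1, 2]), (29, 0, [1, 0, 2, 3, 4, 5]), (57, 0, [1, 2, 5, 0, 3, 4]),
     (30, 0, [5, 0, 1, 2, 3, 4]), (46, 1, [0, 1, 5, 3, 2, 4]), (54, 1, [0, 1, 5, 4, 2, 3])]),
    ([15, 23, 27, 29, 39, 43], [(51, 3, [0, 1, 2, 3, 4, 5]), (53, 4, [0, 1, 2, 3, 4, 5]),
     (57, 4, [0, 1, 3, 2, 4, 5]), (30, 0, [5, 2, 4, 0, 1, 3]), (46, 0, [4, 5, 1, 0, 2, 3]),
     (54, 0, [5, 3, 0, 1, 2, 4]), (58, 0, [5, 2, 0, 1, 3, 4]), (60, 0, [5, 1, 0, 2, 3, 4])]),
    ([15, 23, 27, 29, 39, 57], [(51, 4, [0, 1, 4, 2, 3, 5]), (45, 4, [0, 2, 3, 1, 4, 5]),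
     (53, 4, [0, 2, 4, 1, 3, 5]), (30, 0, [5, 1, 2, 0, 3, 4]), (46, 0, [5, 4, 0, 1, 2, 3]),
     (54, 0, [5, 3, 0, 1, 2, 4]), (58, 0, [5, 2, 0, 1, 3, 4]), (60, 0, [5, 1, 0, 2, 3, 4])]),
    ([15, 23, 27, 39, 43, 53], [(51, 3, [0, 1, 2, 4, 5, 3]), (29, 4, [0, 1, 2, 3, 4, 5]),
     (45, 4, [0, 1, 2, 3, 5, 4]), (57, 2, [2, 3, 4, 5, 1, 0]), (30, 0, [5, 3, 1, 0, 2, 4]),
     (46, 0, [4, 3, 1, 0, 2, 5]), (54, 0, [3, 4, 2, 0, 1, 5]), (58, 5, [0, 1, 2, 3, 4, 5])]),
    ([15, 23, 27, 39, 45, 54], [(43, 0, [4, 3, 0, 1, 2, 5]), (51, 0, [3, 4, 1, 0, 2, 5]),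
     (29, 0, [5, 3, 0, 1, 2, 4]), (53, 0, [3, 5, 2, 0, 1, 4]), (30, 0, [5, 4, 1, 0, 2, 3]),
     (46, 0, [4, 5, 2, 0, 1, 3]), (58, 6, [1, 0, 2, 4, 3, 5]), (60, 6, [2, 0, 1, 5, 3, 4])]),
    ([15, 23, 27, 39, 45, 57], [(51, 2, [2, 4, 3, 5, 1, 0]), (29, 4, [0, 2, 3, 1, 4, 5]),
     (53, 2, [1, 5, 3, 4, 2, 0]), (30, 0, [5, 2, 1, 0, 3, 4]), (46, 0, [4, 1, 2, 0, 3, 5]),
     (54, 6, [0, 1, 2, 3, 4, 5]), (58, 7, [0, 1, 2, 3, 4, 5]), (60, 7, [0, 2, 1, 3, 5, 4])]),
    ([15, 23, 27, 39, 45, 58], [(43, 0, [4, 2, 0, 1, 3, 5]), (51, 5, [0, 1, 2, 4, 3, 5]),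
     (29, 0, [5, 2, 0, 1, 3, 4]), (57, 7, [0, 1, 2, 3, 4, 5]), (30, 0, [5, 4, 1, 0, 2, 3]),
     (46, 0, [4, 0, 2, 1, 3, 5]), (54, 6, [1, 0, 2, 4, 3, 5]), (60, 1, [0, 4, 5, 3, 2, 1])]),
    ([15, 23, 27, 45, 46, 53], [(39, 0, [4, 5, 2, 0, 1, 3]), (43, 0, [4, 1, 3, 0, 2, 5]),
     (29, 0, [5, 4, 0, 1, 2, 3]), (57, 8, [2, 3, 0, 1, 5, 4]), (30, 0, [5, 3, 1, 0, 2, 4]),
     (54, 8, [0, 1, 2, 3, 4, 5]), (58, 1, [0, 1, 5, 3, 2, 4]), (60, 7, [2, 3, 5, 0, 1, 4])]),
    ([15, 23, 27, 45, 53, 60], [(43, 7, [0, 3, 1, 2, 5, 4]), (51, 7, [0, 4, 1, 2, 5, 3]),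
     (29, 0, [1, 5, 2, 0, 3, 4]), (57, 0, [1, 2, 5, 0, 3, 4]), (30, 0, [5, 0, 1, 2, 3, 4]),
     (46, 7, [2, 3, 5, 0, 1, 4]), (54, 7, [2, 4, 5, 0, 1, 3]), (58, 9, [0, 1, 2, 3, 4, 5])]),
    ([15, 23, 27, 45, 54, 60], [(43, 1, [0, 4, 5, 2, 3, 1]), (51, 1, [0, 2, 4, 5, 1, 3]),
     (29, 0, [5, 1, 0, 2, 3, 4]), (53, 7, [2, 4, 5, 0, 1, 3]), (57, 9, [0, 1, 3, 2, 4, 5]),
     (30, 0, [5, 0, 1, 2, 3, 4]), (46, 7, [2, 3, 5, 1, 0, 4]), (58, 9, [1, 0, 4, 2, 3, 5])]),
    ([15, 23, 27, 29, 39], [(45, 10, [0, 2, 1, 3, 4, 5]), (53, 10, [0, 2, 1, 4, 3, 5]),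
     (57, 11, [0, 1, 2, 3, 4, 5]), (30, 0, [5, 3, 4, 0, 1, 2]), (46, 0, [5, 4, 0, 1, 2, 3]),
     (54, 0, [5, 3, 0, 1, 2, 4]), (58, 0, [5, 2, 0, 1, 3, 4]), (60, 0, [5, 1, 0, 2, 3, 4])]),
    ([15, 23, 27, 39, 45], [(51, 12, [0, 1, 2, 4, 3, 5]), (53, 12, [0, 2, 1, 5, 3, 4]),
     (57, 14, [0, 1, 2, 3, 4, 5]), (30, 0, [5, 4, 1, 0, 2, 3]), (46, 0, [4, 5, 2, 0, 1, 3]),
     (54, 13, [0, 1, 2, 3, 4, 5]), (58, 15, [0, 1, 2, 3, 4, 5]), (60, 15, [0, 2, 1, 3, 5, 4])]),
    ([15, 23, 27, 39, 57], [(43, 12, [0, 1, 3, 2, 4, 5]), (51, 12, [0, 1, 4, 2, 3, 5]),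
     (29, 11, [0, 1, 2, 3, 4, 5]), (45, 14, [0, 1, 2, 3, 4, 5]), (53, 14, [0, 1, 2, 4, 3, 5]),
     (30, 0, [5, 2, 1, 0, 3, 4]), (46, 15, [1, 0, 2, 3, 4, 5]), (54, 15, [1, 0, 2, 4, 3, 5])]),
    ([15, 23, 27, 45, 53], [(39, 12, [0, 2, 1, 5, 3, 4]), (43, 14, [0, 1, 3, 2, 4, 5]),
     (51, 14, [0, 1, 4, 2, 3, 5]), (29, 10, [0, 2, 3, 4, 1, 5]), (30, 0, [5, 3, 1, 0, 2, 4]),
     (46, 16, [0, 1, 2, 3, 4, 5]), (54, 16, [0, 1, 2, 4, 3, 5]), (60, 17, [0, 1, 2, 3, 4, 5])]),
    ([15, 23, 27, 45, 54], [(39, 13, [0, 1, 2, 3, 4, 5]), (43, 15, [0, 1, 3, 2, 4, 5]),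
     (51, 15, [1, 0, 4, 2, 3, 5]), (29, 0, [5, 3, 0, 1, 2, 4]), (53, 16, [0, 1, 2, 4, 3, 5]),
     (30, 0, [5, 4, 1, 0, 2, 3]), (46, 16, [1, 0, 2, 3, 4, 5]), (60, 18, [0, 1, 2, 3, 4, 5])]),
    ([15, 23, 27, 45, 60], [(39, 15, [0, 2, 1, 3, 5, 4]), (43, 15, [0, 3, 1, 2, 5, 4]),
     (29, 0, [5, 1, 0, 2, 3, 4]), (53, 17, [0, 1, 2, 3, 4, 5]), (57, 17, [0, 1, 3, 2, 4, 5]),
     (30, 0, [5, 0, 1, 2, 3, 4]), (54, 18, [0, 1, 2, 3, 4, 5]), (58, 18, [0, 1, 3, 2, 4, 5])]),
    ([15, 23, 27, 29], [(51, 19, [0, 1, 4, 2, 3, 5]), (45, 19, [0, 2, 3, 1, 4, 5]),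
     (53, 19, [0, 2, 4, 1, 3, 5]), (57, 19, [0, 3, 4, 1, 2, 5]), (46, 0, [5, 4, 0, 1, 2, 3]),
     (54, 0, [5, 3, 0, 1, 2, 4]), (58, 0, [5, 2, 0, 1, 3, 4]), (60, 0, [5, 1, 0, 2, 3, 4])]),
    ([15, 23, 27, 45], [(51, 21, [0, 1, 4, 2, 3, 5]), (29, 19, [0, 2, 3, 1, 4, 5]),
     (53, 22, [0, 1, 2, 3, 4, 5]), (57, 22, [0, 1, 3, 2, 4, 5]), (30, 0, [5, 4, 1, 0, 2, 3]),
     (54, 23, [0, 1, 2, 3, 4, 5]), (58, 23, [0, 1, 3, 2, 4, 5]), (60, 24, [0, 1, 2, 3, 4, 5])]),
    ([15, 23, 43, 53], [(39, 20, [0, 1, 2, 5, 3, 4]), (27, 21, [0, 1, 3, 2, 4, 5]),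
     (51, 22, [0, 4, 1, 2, 5, 3]), (29, 21, [0, 2, 4, 1, 3, 5]), (45, 22, [0, 3, 2, 1, 5, 4]),
     (30, 23, [1, 2, 0, 3, 4, 5]), (46, 24, [1, 3, 0, 2, 5, 4]), (54, 24, [2, 4, 0, 1, 5, 3])]),
    ([15, 23, 27], [(29, 25, [0, 1, 2, 3, 4, 5]), (45, 26, [0, 1, 2, 3, 4, 5]),
     (53, 26, [0, 1, 2, 4, 3, 5]), (57, 26, [0, 1, 3, 4, 2, 5]), (30, 25, [1, 0, 2, 3, 4, 5]),
     (46, 26, [1, 0, 2, 3, 4, 5]), (54, 26, [1, 0, 2, 4, 3, 5]), (58, 26, [1, 0, 3, 4, 2, 5])]),
    ([15, 23, 43], [(29, 26, [0, 2, 1, 3, 4, 5]), (45, 26, [0, 3, 1, 2, 5, 4]),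
     (53, 27, [0, 1, 2, 3, 4, 5]), (57, 27, [0, 1, 3, 2, 5, 4]), (30, 26, [1, 2, 0, 3, 4, 5]),
     (46, 26, [1, 3, 0, 2, 5, 4]), (54, 27, [1, 0, 2, 3, 4, 5]), (58, 27, [1, 0, 3, 2, 5, 4])]),
    ([15, 23], [(43, 29, [0, 1, 2, 3, 4, 5]), (51, 29, [0, 1, 2, 4, 3, 5]),
     (29, 28, [0, 2, 1, 3, 4, 5]), (45, 29, [0, 2, 1, 3, 4, 5]), (53, 29, [0, 2, 1, 4, 3, 5]),
     (30, 28, [1, 2, 0, 3, 4, 5]), (46, 29, [1, 2, 0, 3, 4, 5]), (54, 29, [1, 2, 0, 4, 3, 5])]),
    ([15], [(23, 30, [0, 1, 2, 3, 4, 5]), (39, 30, [0, 1, 2, 3, 5, 4]),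
     (27, 30, [0, 1, 3, 2, 4, 5]), (43, 30, [0, 1, 3, 2, 5, 4]), (29, 30, [0, 2, 3, 1, 4, 5]),
     (45, 30, [0, 2, 3, 1, 5, 4]), (30, 30, [1, 2, 3, 0, 4, 5]), (46, 30, [1, 2, 3, 0, 5, 4])]),
    ([], [(45, 31, [0, 2, 3, 5, 1, 4]), (53, 31, [0, 2, 4, 5, 1, 3]),
     (57, 31, [0, 3, 4, 5, 1, 2]), (30, 31, [1, 2, 3, 4, 0, 5]), (46, 31, [1, 2, 3, 5, 0, 4]),
     (54, 31, [1, 2, 4, 5, 0, 3]), (58, 31, [1, 3, 4, 5, 0, 2]), (60, 31, [2, 3, 4, 5, 0, 1])])]"

text \<open>Among the six types are three triples on 4 points (the first), four triples through a
  common pair (the fourth) and the Pasch configuration, in which any two of the four triples meet in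
  one point (the last).\<close>

lemma triple_types_certified: "list_all certified triple_types"
  by code_simp

lemma triple_table_ok:
  "table_ok 6 3 4 (map (\<lambda>(cs, T, c). (length cs, T)) triple_types) triple_table"
  by code_simp

lemma quadruple_types_certified: "list_all certified quadruple_types"
  by code_simp

lemma quadruple_table_ok:
  "table_ok 6 4 8 (map (\<lambda>(cs, T, c). (length cs, T)) quadruple_types) quadruple_table"
  by code_simp

text \<open>The codes list the family generated by \<open>{1, 2, 3}, {1, 2, 4}, {4, 5, 6}\<close>. The last list gives
  the sets \<open>Q\<close> of the padded families with their multiplicities, found by linear programming.\<close>

lemma triples_deficient:
  "deficient [1, 2, 3, 4, 5, 6] [0, 7, 11, 15, 56, 59, 63] [(4, 2), (8, 4), (3, 11), (48, 3)]"
  by code_simp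

text \<open>The codes list the empty set and all \<open>{5, 6} \<union> X\<close> with \<open>X \<subseteq> {1, 2, 3, 4}\<close> and
  \<open>2 \<le> card X\<close>.\<close>

lemma quadruples_deficient:
  "deficient [1, 2, 3, 4, 5, 6] [0, 51, 53, 54, 55, 57, 58, 59, 60, 61, 62, 63]
     [(1, 3), (2, 3), (4, 3), (8, 3), (48, 19)]"
  by code_simp

subsection \<open>The bounds\<close>

abbreviation all_generate_FC_at :: "nat \<Rightarrow> nat \<Rightarrow> nat \<Rightarrow> bool" where
  "all_generate_FC_at k n m \<equiv>
     \<forall>S \<subseteq> {X. X \<subseteq> {1..n} \<and> card X = k}. card S = m \<longrightarrow> FC_family (generated S)"

text \<open>The first hypothesis ensures that the least number is attained. Were it at most
  \<open>card R\<close>, some subset of \<open>R\<close> of exactly that size would have to generate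
  an FC-family; hence the last hypothesis covers all subsets of \<open>R\<close>.\<close>

lemma less_FC_number:
  assumes "all_generate_FC_at k n m" and R: "R \<subseteq> {X. X \<subseteq> {1..n} \<and> card X = k}"
    and "\<And>S. S \<subseteq> R \<Longrightarrow> \<not> FC_family (generated S)"
  shows "card R < FC_number k n"
proof (rule ccontr)
  assume "\<not> ?thesis"
  then obtain S where S: "S \<subseteq> R" "card S = FC_number k n"
    by (meson not_less obtain_subset_with_card_n)
  have "all_generate_FC_at k n (FC_number k n)"
    unfolding FC_number_def by (rule LeastI[where P = "all_generate_FC_at k n", OF assms(1)])
  then show False using S R assms(3) by (meson order_trans)
qed

lemma FC_number_le: "all_generate_FC_at k n m \<Longrightarrow> FC_number k n \<le> m"
  unfolding FC_number_def by (rule Least_le)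

theorem theorem2:
  shows "FC_number 3 6 = 4 \<and> 7 \<le> FC_number 4 6 \<and> FC_number 4 6 \<le> 8"
proof -
  have up3: "all_generate_FC_at 3 6 4"
    by (intro allI impI all_generate_FC[OF triple_types_certified triple_table_ok])
      (auto simp: triple_table_def)
  have up4: "all_generate_FC_at 4 6 8"
    by (intro allI impI all_generate_FC[OF quadruple_types_certified quadruple_table_ok])
      (auto simp: quadruple_table_def)
  let ?X = "\<lambda>t. set (sel [1, 2, 3, 4, 5, 6::nat] (dec 6 t))"
  \<comment> \<open>These masks code \<open>{1, 2, 3}\<close>, \<open>{1, 2, 4}\<close> and
    \<open>{4, 5, 6}\<close>.\<close>
  have "card (?X ` {7, 11, 56}) < FC_number 3 6"
  proof (rule less_FC_number[OF up3])
    have "\<forall>t\<in>{7, 11, 56}. ?X t \<subseteq> {1..6} \<and> card (?X t) = 3"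
      by code_simp
    then show "?X ` {7, 11, 56} \<subseteq> {X. X \<subseteq> {1..6} \<and> card X = 3}"
      by blast
    show "\<not> FC_family (generated S)" if "S \<subseteq> ?X ` {7, 11, 56}" for S
      by (rule deficient_not_FC[OF triples_deficient _ order_trans[OF that image_mono]]) simp_all
  qed
  moreover have "card (?X ` {7, 11, 56}) = 3"
    by code_simp
  \<comment> \<open>These masks code the six sets that join \<open>{5, 6}\<close> with a pair from
    \<open>{1, 2, 3, 4}\<close>.\<close>
  moreover have "card (?X ` {51, 53, 54, 57, 58, 60}) < FC_number 4 6"
  proof (rule less_FC_number[OF up4])
    have "\<forall>t\<in>{51, 53, 54, 57, 58, 60}. ?X t \<subseteq> {1..6} \<and> card (?X t) = 4"
      by code_simp
    then show "?X ` {51, 53, 54, 57, 58, 60} \<subseteq> {X. X \<subseteq> {1..6} \<and> card X = 4}"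
      by blast
    show "\<not> FC_family (generated S)" if "S \<subseteq> ?X ` {51, 53, 54, 57, 58, 60}" for S
      by (rule deficient_not_FC[OF quadruples_deficient _ order_trans[OF that image_mono]]) simp_all
  qed
  moreover have "card (?X ` {51, 53, 54, 57, 58, 60}) = 6"
    by code_simp
  moreover have "FC_number 3 6 \<le> 4" "FC_number 4 6 \<le> 8"
    using FC_number_le[OF up3] FC_number_le[OF up4] .
  ultimately show ?thesis by linarith
qed

end
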